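(* Let $M$ be a smooth manifold of dimension $m\geq 2$, let $\varepsilon$ be a locally variational source form on $\mathbb{R}\times T^2M$ with Lepage equivalent $\alpha_\varepsilon$, and let $\alpha'$ be the $2$-form on $TM$ uniquely determined by the decomposition $\alpha_\varepsilon=\alpha_0\wedge dt+\alpha'$ (with $\alpha_0$, $\alpha'$ forms on $TM$), which in a chart $(V,\psi)$, $\psi=(x^i)$, on $M$ has the expression $$\alpha'=\frac14\left(\frac{\partial A_i}{\partial\dot x^j}-\frac{\partial A_j}{\partial\dot x^i}\right)dx^i\wedge dx^j+B_{ij}\,dx^i\wedge d\dot x^j,\qquad \varepsilon_i=A_i+B_{ij}\ddot x^j .$$ Then in every chart $$\alpha'-\omega=d\kappa,$$ where $$\omega=\left(s^1_{1,0}\circ s^1_{2,0}\circ\cdots\circ s^1_{m,0}\circ\pi^1_m\circ\pi^1_{m-1}\circ\cdots\circ\pi^1_1\right)^*\alpha'=\frac14\left(\frac{\partial A_i}{\partial\dot x^j}-\frac{\partial A_j}{\partial\dot x^i}\right)_{(x^p,0)}dx^i\wedge dx^j$$ and $$\kappa=\sum_{l=1}^m(\pi^1_1)^*(\pi^1_2)^*\cdots(\pi^1_{l-1})^*K_l\left((s^1_{l-1,0})^*\cdots(s^1_{2,0})^*(s^1_{1,0})^*\alpha'\right)=-\sum_{l=1}^m\left(\int_0^{\dot x^l}B_{jl}(x^p,0,\ldots,0,\nu,\dot x^{l+1},\ldots,\dot x^m)\,d\nu\right)dx^j .$$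
   Context: Einstein summation over repeated indices is used; all functions and forms are smooth. $TM$ is the tangent bundle and $T^2M$ is the manifold of second-order velocities ($2$-jets at $0\in\mathbb{R}$ of curves in $M$). A chart $(V,\psi)$, $\psi=(x^i)$, on $M$ induces charts with coordinates $(x^i,\dot x^i)$ on $V^1\subset TM$ and $(x^i,\dot x^i,\ddot x^i)$ on $V^2\subset T^2M$, where $V^1$, $V^2$ are the preimages of $V$; $t$ is the coordinate on $\mathbb{R}$. Forms on $TM$ are pulled back to $\mathbb{R}\times TM$ without change of notation. $\pi^{2,1}:\mathbb{R}\times T^2M\to\mathbb{R}\times TM$ is the canonical projection. Put $\omega^i=dx^i-\dot x^i dt$, $\dot\omega^i=d\dot x^i-\ddot x^i dt$. A source form on $\mathbb{R}\times T^2M$ is a $2$-form $\varepsilon$ with chart expression $\varepsilon=\varepsilon_i\,\omega^i\wedge dt$; throughout, $\varepsilon_i=\varepsilon_i(x^j,\dot x^j,\ddot x^j)$ are functions on $V^2$ (independent of $t$). It is locally variational if in charts $(V,\psi)$ covering $M$ there is a function $\mathscr{L}:\mathbb{R}\times V^2\to\mathbb{R}$ with $\varepsilon_i=\frac{\partial\mathscr{L}}{\partial x^i}-\frac{d}{dt}\frac{\partial\mathscr{L}}{\partial\dot x^i}+\frac{d^2}{dt^2}\frac{\partial\mathscr{L}}{\partial\ddot x^i}$. It is a known fact that $\varepsilon$ is locally variational iff in every chart $\varepsilon_i=A_i+B_{ij}\ddot x^j$ with $A_i,B_{ij}$ functions of $(x^k,\dot x^k)$ satisfying the Helmholtz conditions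 $$B_{ij}=B_{ji},\quad \frac{\partial B_{ik}}{\partial\dot x^j}=\frac{\partial B_{jk}}{\partial\dot x^i},\quad \frac{\partial A_i}{\partial\dot x^j}+\frac{\partial A_j}{\partial\dot x^i}-2\frac{\partial B_{ij}}{\partial x^k}\dot x^k=0,$$ $$\frac{\partial A_i}{\partial x^j}-\frac{\partial A_j}{\partial x^i}-\frac12\frac{\partial}{\partial x^k}\left(\frac{\partial A_i}{\partial\dot x^j}-\frac{\partial A_j}{\partial\dot x^i}\right)\dot x^k=0,$$ which also imply $\frac{\partial B_{ik}}{\partial x^j}-\frac{\partial B_{jk}}{\partial x^i}-\frac12\frac{\partial}{\partial\dot x^k}\left(\frac{\partial A_i}{\partial\dot x^j}-\frac{\partial A_j}{\partial\dot x^i}\right)=0$. The Lepage equivalent of a locally variational $\varepsilon$ is the (unique, existing) closed $2$-form $\alpha_\varepsilon$ on $\mathbb{R}\times TM$ such that $(\pi^{2,1})^*\alpha_\varepsilon-\varepsilon$ is $2$-contact (a combination of exterior products of pairs of the forms $\omega^i,\dot\omega^i$). In a chart, $\alpha_\varepsilon=\varepsilon_i\omega^i\wedge dt+\frac14\left(\frac{\partial\varepsilon_i}{\partial\dot x^j}-\frac{\partial\varepsilon_j}{\partial\dot x^i}\right)\omega^i\wedge\omega^j+\frac{\partial\varepsilon_i}{\partial\ddot x^j}\omega^i\wedge\dot\omega^j$. Local projections, sections and homotopy operators, in a fixed chart: for $1\leq l\leq m+1$ let $V^1_l\subset V^1$ be the subset given by $\dot x^j=0$, $1\leq j\leq l-1$,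 with coordinates $(x^i,\dot x^l,\ldots,\dot x^m)$; so $V^1_1=V^1$ and $V^1_{m+1}=V$. For $1\leq l\leq m$ define $\pi^1_l:V^1_l\to V^1_{l+1}$, $\pi^1_l(x^i,\dot x^l,\dot x^{l+1},\ldots,\dot x^m)=(x^i,\dot x^{l+1},\ldots,\dot x^m)$, and for a real number $\nu$, $s^1_{l,\nu}:V^1_{l+1}\to V^1_l$, $s^1_{l,\nu}(x^i,\dot x^{l+1},\ldots,\dot x^m)=(x^i,\nu,\dot x^{l+1},\ldots,\dot x^m)$. For a differential form $\rho$ on $V^1_l$ put $$K_l\rho=\int_0^{\dot x^l}(\pi^1_l)^*(s^1_{l,\nu})^*\left(i_{\partial/\partial\dot x^l}\rho\right)d\nu,$$ where the integration is applied to the coefficients of the form and $i$ denotes contraction. For $l=1$ the pull-backs in the $l$-th summand of $\kappa$ are absent. *)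

theory Defs
  imports "HOL-Analysis.Analysis"
begin

section \<open>Smooth functions and differential forms on open sets of a vector space\<close>

text \<open>\<open>Ck_on k U f\<close> is meant for open \<open>U\<close>.\<close>

primrec Ck_on :: "nat \<Rightarrow> 'e::real_normed_vector set \<Rightarrow> ('e \<Rightarrow> 'f::real_normed_vector) \<Rightarrow> bool" where
  "Ck_on 0 U f \<longleftrightarrow> continuous_on U f"
| "Ck_on (Suc k) U f \<longleftrightarrow>
     f differentiable_on U \<and> (\<forall>u. Ck_on k U (\<lambda>p. frechet_derivative f (at p) u))"

definition smooth_on :: "'e::real_normed_vector set \<Rightarrow> ('e \<Rightarrow> 'f::real_normed_vector) \<Rightarrow> bool" where
  "smooth_on U f \<longleftrightarrow> (\<forall>k. Ck_on k U f)"

definition pd :: "'e::real_normed_vector \<Rightarrow> ('e \<Rightarrow> real) \<Rightarrow> 'e \<Rightarrow> real" where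
  "pd u f p = frechet_derivative f (at p) u"

text \<open>A \<open>k\<close>-form assigns to each point a function of a list of \<open>k\<close> tangent vectors. Values on
  lists of any other length carry no meaning, hence equality of forms is \<open>form_eq\<close>.\<close>

type_synonym 'e form = "'e \<Rightarrow> 'e list \<Rightarrow> real"

definition form_eq :: "nat \<Rightarrow> 'e set \<Rightarrow> 'e form \<Rightarrow> 'e form \<Rightarrow> bool" where
  "form_eq k U \<rho> \<sigma> \<longleftrightarrow> (\<forall>p\<in>U. \<forall>vs. length vs = k \<longrightarrow> \<rho> p vs = \<sigma> p vs)"

definition k_form :: "nat \<Rightarrow> 'e::real_normed_vector set \<Rightarrow> 'e form \<Rightarrow> bool" where
  "k_form k U \<rho> \<longleftrightarrow>
     (\<forall>p\<in>U. \<forall>vs. length vs = k \<longrightarrow>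
        (\<forall>i<k. linear (\<lambda>u. \<rho> p (vs[i := u]))) \<and>
        (\<forall>i<k. \<forall>j<k. i \<noteq> j \<longrightarrow> vs ! i = vs ! j \<longrightarrow> \<rho> p vs = 0)) \<and>
     (\<forall>vs. length vs = k \<longrightarrow> smooth_on U (\<lambda>p. \<rho> p vs))"

definition pullback ::
    "('e::real_normed_vector \<Rightarrow> 'f::real_normed_vector) \<Rightarrow> 'f form \<Rightarrow> 'e form" where
  "pullback f \<rho> = (\<lambda>p vs. \<rho> (f p) (map (frechet_derivative f (at p)) vs))"

definition contract :: "('e \<Rightarrow> 'e) \<Rightarrow> 'e form \<Rightarrow> 'e form" where
  "contract X \<rho> = (\<lambda>p vs. \<rho> p (X p # vs))"

text \<open>Exterior product of two 1-forms, normalised by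
  \<open>(a \<and> b)(u,v) = a(u) b(v) - a(v) b(u)\<close>; this matches the exterior derivative below, so that
  \<open>d(f dx) = df \<and> dx\<close>.\<close>

definition wedge :: "'e form \<Rightarrow> 'e form \<Rightarrow> 'e form" where
  "wedge a b = (\<lambda>p vs. a p [vs ! 0] * b p [vs ! 1] - a p [vs ! 1] * b p [vs ! 0])"

text \<open>Invariant formula for constant vector fields (whose brackets vanish).\<close>

definition ext_deriv :: "'e::real_normed_vector form \<Rightarrow> 'e form" where
  "ext_deriv \<rho> = (\<lambda>p vs. \<Sum>i<length vs.
     (-1) ^ i * frechet_derivative (\<lambda>q. \<rho> q (take i vs @ drop (Suc i) vs)) (at p) (vs ! i))"

section \<open>Smooth manifolds and families of forms\<close>

type_synonym ('b, 'e) chart = "'b set \<times> ('b \<Rightarrow> 'e)"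

definition img :: "('b, 'e) chart \<Rightarrow> 'e set" where
  "img c = snd c ` fst c"

definition overlap :: "('b, 'e) chart \<Rightarrow> ('b, 'e) chart \<Rightarrow> 'e set" where
  "overlap c c' = snd c ` (fst c \<inter> fst c')"

definition transition :: "('b, 'e) chart \<Rightarrow> ('b, 'e) chart \<Rightarrow> 'e \<Rightarrow> 'e" where
  "transition c c' = snd c' \<circ> inv_into (fst c) (snd c)"

definition is_chart :: "('a::topological_space, 'e::real_normed_vector) chart \<Rightarrow> bool" where
  "is_chart c \<longleftrightarrow> open (fst c) \<and> open (img c) \<and> (\<exists>g. homeomorphism (fst c) (img c) (snd c) g)"

definition compatible ::
    "('a::topological_space, 'e::real_normed_vector) chart \<Rightarrow> ('a, 'e) chart \<Rightarrow> bool" where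
  "compatible c c' \<longleftrightarrow>
     smooth_on (overlap c c') (transition c c') \<and> smooth_on (overlap c' c) (transition c' c)"

text \<open>The manifold is the whole type \<open>'a\<close>; \<open>A\<close> is its maximal atlas, i.e. the set of all its
  charts.\<close>

definition smooth_manifold ::
    "('a::{t2_space,second_countable_topology}, real ^ 'm) chart set \<Rightarrow> bool" where
  "smooth_manifold A \<longleftrightarrow>
     (\<forall>c\<in>A. is_chart c) \<and> (\<Union>c\<in>A. fst c) = UNIV \<and>
     (\<forall>c\<in>A. \<forall>c'\<in>A. compatible c c') \<and>
     (\<forall>c. is_chart c \<and> (\<forall>c'\<in>A. compatible c c') \<longrightarrow> c \<in> A)"

text \<open>A \<open>k\<close>-form on a manifold with charts \<open>T c\<close>, \<open>c \<in> A\<close>, is the family of its chart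
  expressions, related to each other by pull-back along the changes of coordinates.
  Here \<open>A\<close> is the atlas of \<open>M\<close> and \<open>T c\<close> the chart induced by \<open>c\<close> on \<open>TM\<close>,
  \<open>R \<times> TM\<close> or \<open>R \<times> T\<^sup>2M\<close>.\<close>

definition form_on ::
    "nat \<Rightarrow> ('c \<Rightarrow> ('b, 'e::real_normed_vector) chart) \<Rightarrow> 'c set \<Rightarrow> ('c \<Rightarrow> 'e form) \<Rightarrow> bool" where
  "form_on k T A \<alpha> \<longleftrightarrow>
     (\<forall>c\<in>A. k_form k (img (T c)) (\<alpha> c)) \<and>
     (\<forall>c\<in>A. \<forall>c'\<in>A. form_eq k (overlap (T c) (T c'))
        (\<alpha> c) (pullback (transition (T c) (T c')) (\<alpha> c')))"

section \<open>First and second order velocities\<close>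

text \<open>Only the germ at \<open>0\<close> of a curve matters, hence curves are total functions which are smooth
  near \<open>0\<close>.\<close>

definition curves :: "('a, real ^ 'm) chart set \<Rightarrow> (real \<Rightarrow> 'a) set" where
  "curves A = {\<gamma>. \<exists>c\<in>A. \<exists>e>0. \<gamma> ` {-e<..<e} \<subseteq> fst c \<and> smooth_on {-e<..<e} (snd c \<circ> \<gamma>)}"

definition vderiv :: "nat \<Rightarrow> (real \<Rightarrow> 'e::real_normed_vector) \<Rightarrow> real \<Rightarrow> 'e" where
  "vderiv k f = ((\<lambda>g t. vector_derivative g (at t)) ^^ k) f"

definition same_jet ::
    "('a, real ^ 'm) chart set \<Rightarrow> nat \<Rightarrow> (real \<Rightarrow> 'a) \<Rightarrow> (real \<Rightarrow> 'a) \<Rightarrow> bool" where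
  "same_jet A r \<gamma> \<delta> \<longleftrightarrow> \<gamma> 0 = \<delta> 0 \<and>
     (\<forall>c\<in>A. \<gamma> 0 \<in> fst c \<longrightarrow> (\<forall>k\<le>r. vderiv k (snd c \<circ> \<gamma>) 0 = vderiv k (snd c \<circ> \<delta>) 0))"

text \<open>\<open>velocities A 1\<close> is \<open>TM\<close> and \<open>velocities A 2\<close> is \<open>T\<^sup>2M\<close>; a jet is an equivalence class
  of curves.\<close>

type_synonym 'a jet = "(real \<Rightarrow> 'a) set"

definition velocities :: "('a, real ^ 'm) chart set \<Rightarrow> nat \<Rightarrow> 'a jet set" where
  "velocities A r = (\<lambda>\<gamma>. {\<delta>\<in>curves A. same_jet A r \<gamma> \<delta>}) ` curves A"

definition velocities_over ::
    "('a, real ^ 'm) chart set \<Rightarrow> nat \<Rightarrow> 'a set \<Rightarrow> 'a jet set" where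
  "velocities_over A r V = {J \<in> velocities A r. \<forall>\<gamma>\<in>J. \<gamma> 0 \<in> V}"

definition jet_coord :: "('a, real ^ 'm) chart \<Rightarrow> nat \<Rightarrow> 'a jet \<Rightarrow> real ^ 'm" where
  "jet_coord c k J = vderiv k (snd c \<circ> (SOME \<gamma>. \<gamma> \<in> J)) 0"

definition T1 :: "('a, real ^ 'm) chart set \<Rightarrow> ('a, real ^ 'm) chart \<Rightarrow>
    ('a jet, (real ^ 'm) \<times> (real ^ 'm)) chart" where
  "T1 A c = (velocities_over A 1 (fst c), \<lambda>J. (jet_coord c 0 J, jet_coord c 1 J))"

definition T2 :: "('a, real ^ 'm) chart set \<Rightarrow> ('a, real ^ 'm) chart \<Rightarrow>
    ('a jet, (real ^ 'm) \<times> (real ^ 'm) \<times> (real ^ 'm)) chart" where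
  "T2 A c = (velocities_over A 2 (fst c),
     \<lambda>J. (jet_coord c 0 J, jet_coord c 1 J, jet_coord c 2 J))"

definition time_chart :: "('b, 'e) chart \<Rightarrow> (real \<times> 'b, real \<times> 'e) chart" where
  "time_chart c = (UNIV \<times> fst c, map_prod id (snd c))"

abbreviation RT1 where "RT1 A c \<equiv> time_chart (T1 A c)"
abbreviation RT2 where "RT2 A c \<equiv> time_chart (T2 A c)"

section \<open>Source forms and their Lepage equivalents\<close>

definition dt :: "(real \<times> 'e) form" where
  "dt p vs = fst (hd vs)"

definition dx :: "'m \<Rightarrow> ((real ^ 'm) \<times> (real ^ 'm)) form" where
  "dx i p vs = fst (hd vs) $ i"

definition dxdot :: "'m \<Rightarrow> ((real ^ 'm) \<times> (real ^ 'm)) form" where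
  "dxdot i p vs = snd (hd vs) $ i"

text \<open>The contact forms \<open>\<omega>\<^sup>i\<close> and \<open>\<omega>dot\<^sup>i\<close>, in the coordinates \<open>(t, x, v, a)\<close> of \<open>R \<times> T\<^sup>2M\<close>.\<close>

definition om :: "'m \<Rightarrow> (real \<times> (real ^ 'm) \<times> (real ^ 'm) \<times> (real ^ 'm)) form" where
  "om i = (\<lambda>(t, x, v, a) vs. case hd vs of (t', x', v', a') \<Rightarrow> x' $ i - v $ i * t')"

definition omdot :: "'m \<Rightarrow> (real \<times> (real ^ 'm) \<times> (real ^ 'm) \<times> (real ^ 'm)) form" where
  "omdot i = (\<lambda>(t, x, v, a) vs. case hd vs of (t', x', v', a') \<Rightarrow> v' $ i - a $ i * t')"

text \<open>\<open>source_expr A c \<epsilon> e\<close>: in the chart induced by \<open>c\<close>,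
  \<open>\<epsilon> = e\<^sub>i \<omega>\<^sup>i \<and> dt\<close> with \<open>e\<^sub>i\<close> functions on \<open>V\<^sup>2\<close> (not depending on \<open>t\<close>).\<close>

definition source_expr :: "('a, real ^ 'm) chart set \<Rightarrow> ('a, real ^ 'm) chart \<Rightarrow>
    (('a, real ^ 'm) chart \<Rightarrow> (real \<times> (real ^ 'm) \<times> (real ^ 'm) \<times> (real ^ 'm)) form) \<Rightarrow>
    ('m \<Rightarrow> (real ^ 'm) \<times> (real ^ 'm) \<times> (real ^ 'm) \<Rightarrow> real) \<Rightarrow> bool" where
  "source_expr A c \<epsilon> e \<longleftrightarrow>
     (\<forall>i. smooth_on (img (T2 A c)) (e i)) \<and>
     form_eq 2 (img (RT2 A c)) (\<epsilon> c) (\<lambda>p vs. \<Sum>i\<in>UNIV. e i (snd p) * wedge (om i) dt p vs)"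

definition source_form :: "('a, real ^ 'm) chart set \<Rightarrow>
    (('a, real ^ 'm) chart \<Rightarrow> (real \<times> (real ^ 'm) \<times> (real ^ 'm) \<times> (real ^ 'm)) form) \<Rightarrow> bool" where
  "source_form A \<epsilon> \<longleftrightarrow> form_on 2 (RT2 A) A \<epsilon> \<and> (\<forall>c\<in>A. \<exists>e. source_expr A c \<epsilon> e)"

text \<open>The total derivative \<open>d/dt\<close> of a function on \<open>R \<times> T\<^sup>2M\<close>, resp. \<open>R \<times> T\<^sup>3M\<close>.\<close>

definition total_deriv2 ::
    "(real \<times> (real ^ 'm) \<times> (real ^ 'm) \<times> (real ^ 'm) \<Rightarrow> real) \<Rightarrow>
     (real \<times> (real ^ 'm) \<times> (real ^ 'm) \<times> (real ^ 'm) \<times> (real ^ 'm) \<Rightarrow> real)" where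
  "total_deriv2 f = (\<lambda>(t, x, v, a, b). frechet_derivative f (at (t, x, v, a)) (1, v, a, b))"

definition total_deriv3 ::
    "(real \<times> (real ^ 'm) \<times> (real ^ 'm) \<times> (real ^ 'm) \<times> (real ^ 'm) \<Rightarrow> real) \<Rightarrow>
     (real \<times> (real ^ 'm) \<times> (real ^ 'm) \<times> (real ^ 'm) \<times> (real ^ 'm) \<times> (real ^ 'm) \<Rightarrow> real)" where
  "total_deriv3 f = (\<lambda>(t, x, v, a, b, c).
     frechet_derivative f (at (t, x, v, a, b)) (1, v, a, b, c))"

definition locally_variational :: "('a, real ^ 'm) chart set \<Rightarrow>
    (('a, real ^ 'm) chart \<Rightarrow> (real \<times> (real ^ 'm) \<times> (real ^ 'm) \<times> (real ^ 'm)) form) \<Rightarrow> bool" where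
  "locally_variational A \<epsilon> \<longleftrightarrow>
     (\<exists>C\<subseteq>A. (\<Union>c\<in>C. fst c) = UNIV \<and>
       (\<forall>c\<in>C. \<exists>L e. smooth_on (img (RT2 A c)) L \<and> source_expr A c \<epsilon> e \<and>
         (\<forall>i t x v a b b'. (x, v, a) \<in> img (T2 A c) \<longrightarrow>
            e i (x, v, a) = pd (0, axis i 1, 0, 0) L (t, x, v, a)
              - total_deriv2 (pd (0, 0, axis i 1, 0) L) (t, x, v, a, b)
              + total_deriv3 (total_deriv2 (pd (0, 0, 0, axis i 1) L)) (t, x, v, a, b, b'))))"

definition two_contact :: "(real \<times> (real ^ 'm) \<times> (real ^ 'm) \<times> (real ^ 'm)) set \<Rightarrow>
    (real \<times> (real ^ 'm) \<times> (real ^ 'm) \<times> (real ^ 'm)) form \<Rightarrow> bool" where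
  "two_contact U \<rho> \<longleftrightarrow>
     (\<exists>P Q R. (\<forall>i j. smooth_on U (P i j) \<and> smooth_on U (Q i j) \<and> smooth_on U (R i j)) \<and>
       form_eq 2 U \<rho> (\<lambda>p vs. \<Sum>i\<in>UNIV. \<Sum>j\<in>UNIV.
         P i j p * wedge (om i) (om j) p vs + Q i j p * wedge (om i) (omdot j) p vs
         + R i j p * wedge (omdot i) (omdot j) p vs))"

text \<open>The canonical projection from \<open>R \<times> T\<^sup>2M\<close> to \<open>R \<times> TM\<close> in induced coordinates.\<close>

definition pi21 :: "real \<times> (real ^ 'm) \<times> (real ^ 'm) \<times> (real ^ 'm) \<Rightarrow>
    real \<times> (real ^ 'm) \<times> (real ^ 'm)" where
  "pi21 = (\<lambda>(t, x, v, a). (t, x, v))"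

definition lepage_equivalent :: "('a, real ^ 'm) chart set \<Rightarrow>
    (('a, real ^ 'm) chart \<Rightarrow> (real \<times> (real ^ 'm) \<times> (real ^ 'm) \<times> (real ^ 'm)) form) \<Rightarrow>
    (('a, real ^ 'm) chart \<Rightarrow> (real \<times> (real ^ 'm) \<times> (real ^ 'm)) form) \<Rightarrow> bool" where
  "lepage_equivalent A \<epsilon> \<alpha> \<longleftrightarrow>
     form_on 2 (RT1 A) A \<alpha> \<and>
     (\<forall>c\<in>A. form_eq 3 (img (RT1 A c)) (ext_deriv (\<alpha> c)) (\<lambda>p vs. 0)) \<and>
     (\<forall>c\<in>A. two_contact (img (RT2 A c)) (\<lambda>p vs. pullback pi21 (\<alpha> c) p vs - \<epsilon> c p vs))"

section \<open>Local projections, sections and homotopy operators\<close>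

text \<open>The indices \<open>1, ..., m\<close> of the chart coordinates are identified with \<open>'m\<close> by an enumeration
  \<open>ix\<close>. The set \<open>V\<^sup>1\<^sub>l\<close> (in coordinates: \<open>fibre_slice ix l W\<close> for
  \<open>W = \<psi>(V)\<close>) is kept as a subset of \<open>V\<^sup>1\<close>, so the coordinates that are missing on it are zero.
  Accordingly the maps between these sets are given by ambient formulas, and forms on
  \<open>V\<^sup>1\<^sub>l\<close> are ambient forms of which only the values at points of \<open>V\<^sup>1\<^sub>l\<close> on vectors tangent to
  \<open>V\<^sup>1\<^sub>l\<close> matter: \<open>fibre_proj_in\<close>, \<open>fibre_sec_in\<close> and \<open>fibre_deriv\<close> show that points
  and tangent vectors go where they should.\<close>

definition fibre_slice ::
    "(nat \<Rightarrow> 'm) \<Rightarrow> nat \<Rightarrow> (real ^ 'm) set \<Rightarrow> ((real ^ 'm) \<times> (real ^ 'm)) set" where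
  "fibre_slice ix l W = {(x, v). x \<in> W \<and> (\<forall>j\<in>{1..<l}. v $ ix j = 0)}"

definition fibre_sec ::
    "(nat \<Rightarrow> 'm) \<Rightarrow> nat \<Rightarrow> real \<Rightarrow> (real ^ 'm) \<times> (real ^ 'm) \<Rightarrow> (real ^ 'm) \<times> (real ^ 'm)" where
  "fibre_sec ix l \<nu> = (\<lambda>(x, v). (x, \<chi> k. if k = ix l then \<nu> else v $ k))"

definition fibre_proj ::
    "(nat \<Rightarrow> 'm) \<Rightarrow> nat \<Rightarrow> (real ^ 'm) \<times> (real ^ 'm) \<Rightarrow> (real ^ 'm) \<times> (real ^ 'm)" where
  "fibre_proj ix l = (\<lambda>(x, v). (x, \<chi> k. if k = ix l then 0 else v $ k))"

definition homotopy_op :: "(nat \<Rightarrow> 'm) \<Rightarrow> nat \<Rightarrow>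
    ((real ^ 'm) \<times> (real ^ 'm)) form \<Rightarrow> ((real ^ 'm) \<times> (real ^ 'm)) form" where
  "homotopy_op ix l \<rho> = (\<lambda>p vs. LBINT \<nu>=0..ereal (snd p $ ix l).
     pullback (fibre_proj ix l)
       (pullback (fibre_sec ix l \<nu>) (contract (\<lambda>_. (0, axis (ix l) 1)) \<rho>)) p vs)"

lemma fibre_proj_in:
  assumes "l \<ge> 1" "p \<in> fibre_slice ix l W"
  shows "fibre_proj ix l p \<in> fibre_slice ix (Suc l) W"
  using assms by (auto simp: fibre_slice_def fibre_proj_def less_Suc_eq)

lemma fibre_sec_in:
  assumes "inj_on ix {1..m}" "1 \<le> l" "l \<le> m" "p \<in> fibre_slice ix (Suc l) W"
  shows "fibre_sec ix l \<nu> p \<in> fibre_slice ix l W" "fibre_proj ix l (fibre_sec ix l \<nu> p) = p"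
proof -
  have "ix j \<noteq> ix l" if "1 \<le> j" "j < l" for j
    using inj_onD[OF assms(1), of j l] assms that by auto
  then show "fibre_sec ix l \<nu> p \<in> fibre_slice ix l W"
    using assms by (auto simp: fibre_slice_def fibre_sec_def)
  show "fibre_proj ix l (fibre_sec ix l \<nu> p) = p"
    using assms by (auto simp: fibre_slice_def fibre_sec_def fibre_proj_def vec_eq_iff)
qed

lemma fibre_deriv:
  "frechet_derivative (fibre_sec ix l \<nu>) (at p) = fibre_proj ix l"
  "frechet_derivative (fibre_proj ix l) (at p) = fibre_proj ix l"
proof -
  have lin: "linear (fibre_proj ix l)"
    by (rule linearI) (auto simp: fibre_proj_def vec_eq_iff)
  then have bl: "bounded_linear (fibre_proj ix l)"
    by (simp add: linear_conv_bounded_linear)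
  then have D: "(fibre_proj ix l has_derivative fibre_proj ix l) (at p)"
    by (rule bounded_linear_imp_has_derivative)
  then show "frechet_derivative (fibre_proj ix l) (at p) = fibre_proj ix l"
    by (rule frechet_derivative_at[symmetric])
  have "fibre_sec ix l \<nu> = (\<lambda>q. fibre_proj ix l q + (0, axis (ix l) \<nu>))"
    by (auto simp: fun_eq_iff fibre_sec_def fibre_proj_def vec_eq_iff axis_def)
  then have "(fibre_sec ix l \<nu> has_derivative fibre_proj ix l) (at p)"
    using has_derivative_add_const[OF D] by simp
  then show "frechet_derivative (fibre_sec ix l \<nu>) (at p) = fibre_proj ix l"
    by (rule frechet_derivative_at[symmetric])
qed

text \<open>\<open>\<pi>\<^sub>m \<circ> ... \<circ> \<pi>\<^sub>1\<close> and \<open>s\<^sub>1 \<circ> ... \<circ> s\<^sub>m\<close> (the sections at \<open>\<nu> = 0\<close>).\<close>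

definition all_proj :: "(nat \<Rightarrow> 'm) \<Rightarrow> (real ^ 'm) \<times> (real ^ 'm) \<Rightarrow> (real ^ 'm) \<times> (real ^ 'm)" where
  "all_proj ix = fold (\<lambda>l g. fibre_proj ix l \<circ> g) [1..<Suc CARD('m::finite)] id"

definition all_sec :: "(nat \<Rightarrow> 'm) \<Rightarrow> (real ^ 'm) \<times> (real ^ 'm) \<Rightarrow> (real ^ 'm) \<times> (real ^ 'm)" where
  "all_sec ix = foldr (\<lambda>l g. fibre_sec ix l 0 \<circ> g) [1..<Suc CARD('m::finite)] id"

definition omega_form :: "(nat \<Rightarrow> 'm::finite) \<Rightarrow>
    ((real ^ 'm) \<times> (real ^ 'm)) form \<Rightarrow> ((real ^ 'm) \<times> (real ^ 'm)) form" where
  "omega_form ix \<rho> = pullback (all_sec ix \<circ> all_proj ix) \<rho>"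

text \<open>In the \<open>l\<close>-th summand \<open>fold\<close> applies the pull-back by \<open>s\<^sub>1\<close> first and the one by
  \<open>s\<^sub>l\<^sub>-\<^sub>1\<close> last, while \<open>foldr\<close> applies the one by \<open>\<pi>\<^sub>l\<^sub>-\<^sub>1\<close> first and the one by \<open>\<pi>\<^sub>1\<close> last.\<close>

definition kappa_form :: "(nat \<Rightarrow> 'm::finite) \<Rightarrow>
    ((real ^ 'm) \<times> (real ^ 'm)) form \<Rightarrow> ((real ^ 'm) \<times> (real ^ 'm)) form" where
  "kappa_form ix \<rho> = (\<lambda>p vs. \<Sum>l=1..CARD('m).
     foldr (\<lambda>j. pullback (fibre_proj ix j)) [1..<l]
       (homotopy_op ix l (fold (\<lambda>j. pullback (fibre_sec ix j 0)) [1..<l] \<rho>)) p vs)"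

text \<open>\<open>\<partial>A\<^sub>i/\<partial>xdot\<^sup>j - \<partial>A\<^sub>j/\<partial>xdot\<^sup>i\<close>\<close>

definition alt_vderiv :: "('m \<Rightarrow> (real ^ 'm) \<times> (real ^ 'm) \<Rightarrow> real) \<Rightarrow>
    'm \<Rightarrow> 'm \<Rightarrow> (real ^ 'm) \<times> (real ^ 'm) \<Rightarrow> real" where
  "alt_vderiv a i j p = pd (0, axis j 1) (a i) p - pd (0, axis i 1) (a j) p"

end

theory Submission
  imports Defs
begin

text \<open>
  The statement is local: in one chart with image \<open>W\<close> the induced chart on \<open>TM\<close> has image
  \<open>W \<times> UNIV\<close>, and everything follows there from two facts about \<open>\<alpha>'\<close>.

  \<^item> Contract \<open>\<alpha>\<^sub>\<epsilon> - \<epsilon>\<close>, which is 2-contact, with the total derivative vector \<open>(1, v, a, 0)\<close>. All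
    contact forms vanish on this vector, so one obtains \<open>e\<^sub>i dx\<^sup>i = \<alpha>\<^sub>0 - \<alpha>'((v, a), _)\<close> on spatial
    vectors, for every acceleration \<open>a\<close> (\<open>lepage_contraction\<close>). The left-hand side vanishes on
    vertical vectors; hence \<open>\<alpha>'\<close> vanishes on pairs of vertical vectors and \<open>\<alpha>\<^sub>0\<close> is determined on
    vertical vectors by \<open>\<alpha>'\<close>. The right-hand side is affine in \<open>a\<close>, with coefficients \<open>B\<^sub>i\<^sub>j\<close>
    given by \<open>\<alpha>'\<close>.

  \<^item> As \<open>\<alpha>\<^sub>\<epsilon>\<close> is closed and \<open>\<alpha>\<^sub>0\<close>, \<open>\<alpha>'\<close> do not depend on time, both are closed
    (\<open>closed_components\<close>). Together with the first fact, this yields the symmetry of \<open>B\<close> and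
    \<open>\<alpha>'(\<partial>/\<partial>x\<^sup>i, \<partial>/\<partial>x\<^sup>j) = (\<partial>A\<^sub>i/\<partial>xdot\<^sup>j - \<partial>A\<^sub>j/\<partial>xdot\<^sup>i) / 2\<close> (\<open>alt_vderiv_force\<close>), that is, the
    coordinate expression of \<open>\<alpha>'\<close>.

  For the homotopy formula, compare \<open>\<kappa>\<close>, which integrates \<open>\<alpha>'\<close> along the edges of a polygon from
  \<open>(x, 0)\<close> to \<open>(x, v)\<close>, with the radial potential \<open>R\<close> whose value at \<open>(x, v)\<close> on \<open>u\<close> is the integral
  over \<open>s\<close> in \<open>[0, 1]\<close> of the value of \<open>\<alpha>'\<close> at \<open>(x, s v)\<close> on \<open>(0, v), u\<close>. For a closed form which
  vanishes on vertical pairs, differentiation under the integral and the fundamental theorem of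
  calculus give \<open>dR = \<alpha>' - \<omega>\<close> (\<open>ext_deriv_radial_potential\<close>), and a vertical slot of this equation
  says that \<open>\<partial>R(u)/\<partial>xdot\<^sup>l = \<alpha>'(\<partial>/\<partial>xdot\<^sup>l, u)\<close>. So the \<open>l\<close>-th summand of \<open>\<kappa>\<close> is the increment
  of \<open>R\<close> along the \<open>l\<close>-th edge, the sum telescopes, and \<open>\<kappa> = R\<close>
  (\<open>kappa_form_eq_radial_potential\<close>). This way no integral with a variable endpoint has to be
  differentiated together with its parameters.
\<close>

section \<open>Smooth functions\<close>

text \<open>Differentiability is not assumed: where it fails, both sides are the same arbitrary choice.\<close>

lemma frechet_derivative_cong_open:
  assumes "open U" "p \<in> U" "\<And>q. q \<in> U \<Longrightarrow> f q = g q"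
  shows "frechet_derivative f (at p) = frechet_derivative g (at p)"
proof -
  have "(f has_derivative D) (at p) \<longleftrightarrow> (g has_derivative D) (at p)" for D
    using has_derivative_transform_within_open[OF _ assms(1,2)] assms(3) by metis
  then show ?thesis
    by (simp add: frechet_derivative_def)
qed

lemma differentiable_on_cong_open:
  assumes "open U" "\<And>q. q \<in> U \<Longrightarrow> f q = g q" "f differentiable_on U"
  shows "g differentiable_on U"
  using assms has_derivative_transform_within_open[OF _ assms(1)]
  unfolding differentiable_on_eq_differentiable_at[OF assms(1)] differentiable_def by metis

lemma Ck_on_cong:
  assumes "open U" "\<And>q. q \<in> U \<Longrightarrow> f q = g q" "Ck_on k U f"
  shows "Ck_on k U g"
  using assms(2,3)
proof (induction k arbitrary: f g)
  case 0
  then show ?case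
    using continuous_on_cong[of U U f g] by simp
next
  case (Suc k)
  have "Ck_on k U (\<lambda>p. frechet_derivative g (at p) u)" for u
    using Suc.IH[of "\<lambda>p. frechet_derivative f (at p) u" "\<lambda>p. frechet_derivative g (at p) u"]
      frechet_derivative_cong_open[OF assms(1), of _ f g] Suc.prems by simp
  then show ?case
    using differentiable_on_cong_open[OF assms(1), of f g] Suc.prems by simp
qed

lemma smooth_on_cong:
  assumes "open U" "\<And>q. q \<in> U \<Longrightarrow> f q = g q" "smooth_on U f"
  shows "smooth_on U g"
  using assms Ck_on_cong unfolding smooth_on_def by metis

lemma smooth_on_has_derivative:
  assumes "smooth_on U f" "open U" "p \<in> U"
  shows "(f has_derivative frechet_derivative f (at p)) (at p)"
proof -
  have "Ck_on (Suc 0) U f"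
    using assms(1) by (simp add: smooth_on_def)
  then show ?thesis
    using assms(2,3) by (simp add: differentiable_on_eq_differentiable_at frechet_derivative_works)
qed

lemma smooth_on_continuous:
  assumes "smooth_on U f"
  shows "continuous_on U f"
  using assms Ck_on.simps(1) unfolding smooth_on_def by metis

lemma smooth_on_continuous_derivative:
  assumes "smooth_on U f"
  shows "continuous_on U (\<lambda>p. frechet_derivative f (at p) u)"
proof -
  have "Ck_on (Suc 0) U f"
    using assms by (simp add: smooth_on_def)
  then show ?thesis
    by simp
qed

lemma smooth_on_compose_linear:
  fixes f :: "'e::real_normed_vector \<Rightarrow> 'f::real_normed_vector"
  assumes "smooth_on U f" "open U" "open V" "bounded_linear L" "L ` V \<subseteq> U"
  shows "smooth_on V (\<lambda>p. f (L p))"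
proof -
  have "Ck_on k V (\<lambda>p. f (L p))" if "Ck_on k U f" for k and f :: "'e \<Rightarrow> 'f"
    using that
  proof (induction k arbitrary: f)
    case 0
    have "continuous_on V L"
      using assms(4) by (simp add: linear_continuous_on)
    then show ?case
      using 0 continuous_on_compose2[of U f V L] assms(5) by auto
  next
    case (Suc k)
    have D: "((\<lambda>p. f (L p)) has_derivative (\<lambda>h. frechet_derivative f (at (L p)) (L h))) (at p)"
      if "p \<in> V" for p
    proof -
      have "(f has_derivative frechet_derivative f (at (L p))) (at (L p))"
        using Suc.prems that assms(2,5)
        by (auto simp: differentiable_on_eq_differentiable_at frechet_derivative_works)
      then show ?thesis
        using has_derivative_compose[OF bounded_linear_imp_has_derivative[OF assms(4)]] by blast
    qed
    have "(\<lambda>p. f (L p)) differentiable_on V"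
      using D by (auto simp: differentiable_on_eq_differentiable_at[OF assms(3)] differentiable_def)
    moreover have "Ck_on k V (\<lambda>p. frechet_derivative (\<lambda>p. f (L p)) (at p) u)" for u
    proof (rule Ck_on_cong[OF assms(3)])
      show "Ck_on k V (\<lambda>p. frechet_derivative f (at (L p)) (L u))"
        using Suc.IH[of "\<lambda>q. frechet_derivative f (at q) (L u)"] Suc.prems by simp
      show "frechet_derivative f (at (L p)) (L u) = frechet_derivative (\<lambda>p. f (L p)) (at p) u"
        if "p \<in> V" for p
        using frechet_derivative_at[OF D[OF that]] by metis
    qed
    ultimately show ?case
      by simp
  qed
  then show ?thesis
    using assms(1) by (simp add: smooth_on_def)
qed

lemma quadratic_has_vector_derivative:
  "((\<lambda>t::real. x + t *\<^sub>R v + (t\<^sup>2 / 2) *\<^sub>R a) has_vector_derivative (v + t *\<^sub>R a)) (at t)"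
  for x v a :: "'e::real_normed_vector"
  by (auto intro!: derivative_eq_intros simp: algebra_simps)

text \<open>Quadratic curves realise all 2-jets. The derivative of such a curve is again of this form, which
  makes the induction work.\<close>

lemma quadratic_smooth: "smooth_on U (\<lambda>t::real. x + t *\<^sub>R v + (t\<^sup>2 / 2) *\<^sub>R a)"
  for x v a :: "'e::real_normed_vector"
proof -
  have "Ck_on k U (\<lambda>t::real. x + t *\<^sub>R v + (t\<^sup>2 / 2) *\<^sub>R a)" for k x v and a :: 'e
  proof (induction k arbitrary: x v a)
    case 0
    show ?case
      by (auto intro!: continuous_intros)
  next
    case (Suc k)
    have D: "((\<lambda>t. x + t *\<^sub>R v + (t\<^sup>2 / 2) *\<^sub>R a) has_derivative (\<lambda>h. h *\<^sub>R (v + t *\<^sub>R a))) (at t)"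
      for t
      using quadratic_has_vector_derivative[of x v a t] by (simp add: has_vector_derivative_def)
    have "frechet_derivative (\<lambda>t. x + t *\<^sub>R v + (t\<^sup>2 / 2) *\<^sub>R a) (at t) u
        = u *\<^sub>R v + t *\<^sub>R (u *\<^sub>R a) + (t\<^sup>2 / 2) *\<^sub>R 0" for t u
      unfolding frechet_derivative_at[OF D[of t], symmetric] by (simp add: algebra_simps)
    then have "Ck_on k U (\<lambda>t. frechet_derivative (\<lambda>t. x + t *\<^sub>R v + (t\<^sup>2 / 2) *\<^sub>R a) (at t) u)" for u
      using Suc.IH[of "u *\<^sub>R v" "u *\<^sub>R a" 0] by (simp only:)
    moreover have "(\<lambda>t. x + t *\<^sub>R v + (t\<^sup>2 / 2) *\<^sub>R a) differentiable_on U"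
      using D by (meson differentiable_def differentiable_at_imp_differentiable_on)
    ultimately show ?case
      by simp
  qed
  then show ?thesis
    by (simp add: smooth_on_def)
qed

section \<open>Images of the induced charts\<close>

lemma vderiv_quadratic:
  fixes x v a :: "'e::real_normed_vector"
  assumes "e > 0" "\<And>t. \<bar>t\<bar> < e \<Longrightarrow> f t = x + t *\<^sub>R v + (t\<^sup>2 / 2) *\<^sub>R a"
  shows "vderiv 0 f 0 = x" "vderiv 1 f 0 = v" "vderiv 2 f 0 = a"
proof -
  have f': "vector_derivative f (at t) = v + t *\<^sub>R a" if "\<bar>t\<bar> < e" for t
  proof (rule vector_derivative_at)
    show "(f has_vector_derivative (v + t *\<^sub>R a)) (at t)"
      by (rule has_vector_derivative_transform_within_open[OF quadratic_has_vector_derivative[of x v a],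
            where S = "{-e<..<e}"]) (use that assms in auto)
  qed
  have "((\<lambda>t. v + t *\<^sub>R a) has_vector_derivative a) (at 0)"
    by (auto intro!: derivative_eq_intros)
  then have "((\<lambda>t. vector_derivative f (at t)) has_vector_derivative a) (at 0)"
    by (rule has_vector_derivative_transform_within_open[where S = "{-e<..<e}"])
      (use f' assms in auto)
  then have "vector_derivative (\<lambda>t. vector_derivative f (at t)) (at 0) = a"
    by (rule vector_derivative_at)
  then show "vderiv 2 f 0 = a"
    by (simp add: vderiv_def numeral_2_eq_2)
  show "vderiv 0 f 0 = x" "vderiv 1 f 0 = v"
    using f'[of 0] assms by (simp_all add: vderiv_def)
qed

text \<open>The jet of \<open>\<psi>\<inverse>(x + t v + t\<^sup>2 a / 2)\<close>. Away from small \<open>t\<close> this curve has arbitrary values,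
  which a jet does not see. As \<^const>\<open>jet_coord\<close> evaluates an arbitrary representative, the
  definition of \<^const>\<open>same_jet\<close> is needed to return to this one.\<close>

lemma velocity_with_coords:
  fixes A :: "('a::{t2_space,second_countable_topology}, real ^ 'm) chart set"
  assumes "c \<in> A" "is_chart c" "x \<in> img c" "r \<le> 2"
  obtains J where "J \<in> velocities_over A r (fst c)"
    and "\<And>k. k \<le> r \<Longrightarrow> jet_coord c k J = (if k = 0 then x else if k = 1 then v else a)"
proof -
  define q where "q = (\<lambda>t::real. x + t *\<^sub>R v + (t\<^sup>2 / 2) *\<^sub>R a)"
  have op: "open (img c)"
    using assms(2) by (simp add: is_chart_def)
  have "continuous_on UNIV q"
    unfolding q_def by (auto intro!: continuous_intros)
  then have "open (q -` img c)"
    using op by (simp add: open_vimage)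
  moreover have "0 \<in> q -` img c"
    using assms(3) by (simp add: q_def)
  ultimately obtain e where e: "e > 0" "ball 0 e \<subseteq> q -` img c"
    by (meson open_contains_ball)
  then have q: "q t \<in> img c" if "\<bar>t\<bar> < e" for t
    using that by (auto simp: subset_iff)
  define \<gamma> where "\<gamma> = inv_into (fst c) (snd c) \<circ> q"
  have \<gamma>: "\<gamma> t \<in> fst c" "snd c (\<gamma> t) = q t" if "\<bar>t\<bar> < e" for t
    using q[OF that] by (auto simp: \<gamma>_def img_def inv_into_into f_inv_into_f)
  have "smooth_on {-e<..<e} (snd c \<circ> \<gamma>)"
  proof (rule smooth_on_cong[of _ q])
    show "smooth_on {-e<..<e} q"
      unfolding q_def by (rule quadratic_smooth)
  qed (use \<gamma> in auto)
  then have \<gamma>_curve: "\<gamma> \<in> curves A"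
    unfolding curves_def using \<gamma>(1) e(1) assms(1)
    by (intro CollectI bexI[of _ c] exI[of _ e]) auto
  define J where "J = {\<delta>\<in>curves A. same_jet A r \<gamma> \<delta>}"
  have "\<gamma> \<in> J"
    using \<gamma>_curve by (simp add: J_def same_jet_def)
  define \<delta> where "\<delta> = (SOME \<delta>. \<delta> \<in> J)"
  have "\<delta> \<in> J"
    unfolding \<delta>_def using \<open>\<gamma> \<in> J\<close> by (metis someI)
  then have \<delta>: "vderiv k (snd c \<circ> \<delta>) 0 = vderiv k (snd c \<circ> \<gamma>) 0" if "k \<le> r" for k
    using \<gamma>(1)[of 0] e(1) assms(1) that by (simp add: J_def same_jet_def)
  have "J \<in> velocities_over A r (fst c)"
    using \<gamma>_curve \<gamma>(1)[of 0] e(1)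
    by (auto simp: velocities_over_def velocities_def J_def same_jet_def)
  moreover have "jet_coord c k J = (if k = 0 then x else if k = 1 then v else a)" if "k \<le> r" for k
  proof -
    have "(snd c \<circ> \<gamma>) t = x + t *\<^sub>R v + (t\<^sup>2 / 2) *\<^sub>R a" if "\<bar>t\<bar> < e" for t
      using \<gamma>(2)[OF that] by (simp add: q_def)
    note \<gamma>_jet = vderiv_quadratic[of e "snd c \<circ> \<gamma>", OF e(1) this]
    have "k = 0 \<or> k = 1 \<or> k = 2"
      using that assms(4) by linarith
    then show ?thesis
      unfolding jet_coord_def \<delta>_def[symmetric] \<delta>[OF that]
      by (elim disjE) (simp_all only: \<gamma>_jet, simp_all)
  qed
  ultimately show ?thesis
    by (rule that)
qed

lemma jet_coord_0_in_img:
  assumes "J \<in> velocities_over A r (fst c)"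
  shows "jet_coord c 0 J \<in> img c"
proof -
  have "\<exists>\<gamma>. \<gamma> \<in> J"
    using assms by (auto simp: velocities_over_def velocities_def same_jet_def)
  then have "(SOME \<gamma>. \<gamma> \<in> J) \<in> J"
    by (rule someI_ex)
  then show ?thesis
    using assms by (auto simp: velocities_over_def jet_coord_def vderiv_def img_def)
qed

lemma img_T1:
  fixes A :: "('a::{t2_space,second_countable_topology}, real ^ 'm) chart set"
  assumes "c \<in> A" "is_chart c"
  shows "img (T1 A c) = img c \<times> UNIV"
proof
  show "img (T1 A c) \<subseteq> img c \<times> UNIV"
    using jet_coord_0_in_img[of _ A 1 c]
    by (auto simp: img_def[of "(velocities_over _ _ _, _)"] T1_def)
  show "img c \<times> UNIV \<subseteq> img (T1 A c)"
  proof clarify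
    fix x v assume "x \<in> img c"
    then obtain J where "J \<in> velocities_over A 1 (fst c)" "jet_coord c 0 J = x" "jet_coord c 1 J = v"
      using velocity_with_coords[OF assms, of x 1 v 0]
      by (metis le_numeral_extra(4) one_le_numeral zero_le_one zero_neq_one)
    then show "(x, v) \<in> img (T1 A c)"
      by (force simp: img_def T1_def)
  qed
qed

lemma img_T2:
  fixes A :: "('a::{t2_space,second_countable_topology}, real ^ 'm) chart set"
  assumes "c \<in> A" "is_chart c"
  shows "img (T2 A c) = img c \<times> UNIV \<times> UNIV"
proof
  show "img (T2 A c) \<subseteq> img c \<times> UNIV \<times> UNIV"
    using jet_coord_0_in_img[of _ A 2 c]
    by (auto simp: img_def[of "(velocities_over _ _ _, _)"] T2_def)
  show "img c \<times> UNIV \<times> UNIV \<subseteq> img (T2 A c)"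
  proof clarify
    fix x v a assume "x \<in> img c"
    then obtain J where "J \<in> velocities_over A 2 (fst c)"
        "jet_coord c 0 J = x" "jet_coord c 1 J = v" "jet_coord c 2 J = a"
      using velocity_with_coords[OF assms, of x 2 v a]
      by (metis one_le_numeral order_refl zero_le zero_neq_numeral zero_neq_one one_eq_numeral_iff
          numeral_eq_one_iff semiring_norm(85))
    then show "(x, v, a) \<in> img (T2 A c)"
      by (force simp: img_def T2_def)
  qed
qed

lemma img_time_chart: "img (time_chart c) = UNIV \<times> img c"
  by (force simp: img_def time_chart_def)

section \<open>Calculus of coefficients of forms\<close>

definition coeff_deriv ::
    "'e::real_normed_vector form \<Rightarrow> 'e \<Rightarrow> 'e \<Rightarrow> 'e list \<Rightarrow> real" where
  "coeff_deriv \<rho> p h vs = frechet_derivative (\<lambda>q. \<rho> q vs) (at p) h"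

lemma ext_deriv_1:
  "ext_deriv \<rho> p [u, w] = coeff_deriv \<rho> p u [w] - coeff_deriv \<rho> p w [u]"
  by (simp add: ext_deriv_def coeff_deriv_def)

lemma ext_deriv_2:
  "ext_deriv \<rho> p [u, v, w] =
    coeff_deriv \<rho> p u [v, w] - coeff_deriv \<rho> p v [u, w] + coeff_deriv \<rho> p w [u, v]"
  by (simp add: ext_deriv_def coeff_deriv_def eval_nat_numeral)

lemma ext_deriv_cong_open:
  fixes \<rho> \<sigma> :: "'e::real_normed_vector form"
  assumes "form_eq k U \<rho> \<sigma>" "open U"
  shows "form_eq (Suc k) U (ext_deriv \<rho>) (ext_deriv \<sigma>)"
  unfolding form_eq_def ext_deriv_def
proof (intro ballI allI impI sum.cong refl)
  fix p and vs :: "'e list" and i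
  assume "p \<in> U" "length vs = Suc k" "i \<in> {..<length vs}"
  then have "frechet_derivative (\<lambda>q. \<rho> q (take i vs @ drop (Suc i) vs)) (at p)
      = frechet_derivative (\<lambda>q. \<sigma> q (take i vs @ drop (Suc i) vs)) (at p)"
    using assms(1) by (intro frechet_derivative_cong_open[OF assms(2)]) (auto simp: form_eq_def)
  then show "(-1) ^ i * frechet_derivative (\<lambda>q. \<rho> q (take i vs @ drop (Suc i) vs)) (at p) (vs ! i)
      = (-1) ^ i * frechet_derivative (\<lambda>q. \<sigma> q (take i vs @ drop (Suc i) vs)) (at p) (vs ! i)"
    by simp
qed

lemma k_form_has_derivative:
  assumes "k_form k U \<rho>" "open U" "p \<in> U" "length vs = k"
  shows "((\<lambda>q. \<rho> q vs) has_derivative (\<lambda>h. coeff_deriv \<rho> p h vs)) (at p)"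
  using smooth_on_has_derivative[of U "\<lambda>q. \<rho> q vs"] assms
  by (auto simp: k_form_def coeff_deriv_def)

lemma k_form_linear_2:
  assumes "k_form 2 U \<rho>" "p \<in> U"
  shows "linear (\<lambda>u. \<rho> p [u, w])" "linear (\<lambda>u. \<rho> p [w, u])"
proof -
  have "length [w, w] = 2"
    by simp
  then have "\<forall>i<2. linear (\<lambda>u. \<rho> p ([w, w][i := u]))"
    using assms unfolding k_form_def by blast
  from this[rule_format, of 0] this[rule_format, of 1]
  show "linear (\<lambda>u. \<rho> p [u, w])" "linear (\<lambda>u. \<rho> p [w, u])"
    by simp_all
qed

lemma k_form_swap:
  assumes "k_form 2 U \<rho>" "p \<in> U"
  shows "\<rho> p [w, u] = - \<rho> p [u, w]"
proof -
  have alt: "\<rho> p [z, z] = 0" for z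
  proof -
    have "\<forall>i<2. \<forall>j<2. i \<noteq> j \<longrightarrow> [z, z] ! i = [z, z] ! j \<longrightarrow> \<rho> p [z, z] = 0"
      using assms by (simp add: k_form_def)
    from this[rule_format, of 0 1] show ?thesis
      by simp
  qed
  have "0 = \<rho> p [u + w, u + w]"
    by (simp add: alt)
  also have "\<dots> = \<rho> p [u, u + w] + \<rho> p [w, u + w]"
    by (rule linear_add[OF k_form_linear_2(1)[OF assms]])
  also have "\<dots> = \<rho> p [u, w] + \<rho> p [w, u]"
    by (simp add: linear_add[OF k_form_linear_2(2)[OF assms]] alt)
  finally show ?thesis
    by simp
qed

text \<open>A coefficient stays linear in its slot after differentiation in the base point, because
  linearity holds on a whole neighbourhood.\<close>

lemma linear_coeff_deriv:
  assumes "open U" "p \<in> U" "\<And>q. q \<in> U \<Longrightarrow> linear (\<lambda>u. \<rho> q (f u))"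
    and "\<And>u. ((\<lambda>q. \<rho> q (f u)) has_derivative (\<lambda>h. coeff_deriv \<rho> p h (f u))) (at p)"
  shows "linear (\<lambda>u. coeff_deriv \<rho> p h (f u))"
proof (rule linearI)
  have *: "coeff_deriv \<rho> p h (f w) = D h"
    if "(g has_derivative D) (at p)" "\<And>q. q \<in> U \<Longrightarrow> g q = \<rho> q (f w)" for g D w
    using frechet_derivative_cong_open[OF assms(1,2), of g "\<lambda>q. \<rho> q (f w)"]
      frechet_derivative_at[OF that(1)] that(2) by (simp add: coeff_deriv_def)
  fix u v c
  show "coeff_deriv \<rho> p h (f (u + v)) = coeff_deriv \<rho> p h (f u) + coeff_deriv \<rho> p h (f v)"
    by (rule *[OF has_derivative_add[OF assms(4)[of u] assms(4)[of v]]])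
      (simp add: linear_add[OF assms(3)])
  show "coeff_deriv \<rho> p h (f (c *\<^sub>R u)) = c *\<^sub>R coeff_deriv \<rho> p h (f u)"
    by (rule *[OF has_derivative_scaleR_right[OF assms(4)[of u], of c]])
      (simp add: linear_cmul[OF assms(3)])
qed

lemma coeff_deriv_linear_2:
  assumes "k_form 2 U \<rho>" "open U" "p \<in> U"
  shows "linear (\<lambda>u. coeff_deriv \<rho> p h [u, w])" "linear (\<lambda>u. coeff_deriv \<rho> p h [w, u])"
  using linear_coeff_deriv[of U p \<rho> "\<lambda>u. [u, w]" h] linear_coeff_deriv[of U p \<rho> "\<lambda>u. [w, u]" h]
    k_form_has_derivative[OF assms] k_form_linear_2[OF assms(1)] assms(2,3) by simp_all

lemma coeff_deriv_linear_dir: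
  assumes "k_form k U \<rho>" "open U" "p \<in> U" "length vs = k"
  shows "linear (\<lambda>h. coeff_deriv \<rho> p h vs)"
  using k_form_has_derivative[OF assms] by (rule has_derivative_linear)

lemma coeff_deriv_cong_open:
  assumes "open U" "p \<in> U" "\<And>q. q \<in> U \<Longrightarrow> \<rho> q vs = \<sigma> q ws"
  shows "coeff_deriv \<rho> p h vs = coeff_deriv \<sigma> p h ws"
  unfolding coeff_deriv_def
  using frechet_derivative_cong_open[OF assms(1,2), of "\<lambda>q. \<rho> q vs" "\<lambda>q. \<sigma> q ws"] assms(3) by simp

text \<open>A product rule for a slot whose vector depends linearly on the point. Smoothness of a form
  concerns fixed vectors only, so the slot is expanded in a basis.\<close>

lemma has_derivative_linear_slot:
  fixes \<rho> :: "'e::real_normed_vector form" and L :: "'e \<Rightarrow> 'b::euclidean_space" and j :: "'b \<Rightarrow> 'e"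
  assumes "k_form 2 U \<rho>" "open U" "p \<in> U" "bounded_linear L" "linear j"
  shows "((\<lambda>q. \<rho> q [j (L q), w]) has_derivative
      (\<lambda>h. coeff_deriv \<rho> p h [j (L p), w] + \<rho> p [j (L h), w])) (at p)"
proof -
  have expand: "f (j (L q)) = (\<Sum>e\<in>Basis. (L q \<bullet> e) * f (j e))"
    if "linear f" for f :: "'e \<Rightarrow> real" and q
  proof -
    have lin: "linear (\<lambda>x. f (j x))"
      using linear_compose[OF assms(5) that] by (simp add: o_def)
    have "f (j (L q)) = f (j (\<Sum>e\<in>Basis. (L q \<bullet> e) *\<^sub>R e))"
      by (simp only: euclidean_representation)
    also have "\<dots> = (\<Sum>e\<in>Basis. f (j ((L q \<bullet> e) *\<^sub>R e)))"
      by (rule linear_sum[OF lin])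
    also have "\<dots> = (\<Sum>e\<in>Basis. (L q \<bullet> e) * f (j e))"
      using linear_cmul[OF lin] by (intro sum.cong refl) simp
    finally show ?thesis .
  qed
  have \<rho>: "\<rho> q [j (L q'), w] = (\<Sum>e\<in>Basis. (L q' \<bullet> e) * \<rho> q [j e, w])" if "q \<in> U" for q q'
    by (rule expand[OF k_form_linear_2(1)[OF assms(1) that]])
  have D\<rho>: "coeff_deriv \<rho> p h [j (L p), w] = (\<Sum>e\<in>Basis. (L p \<bullet> e) * coeff_deriv \<rho> p h [j e, w])" for h
    by (rule expand[OF coeff_deriv_linear_2(1)[OF assms(1-3)]])
  have L: "(L has_derivative L) (at p)"
    using assms(4) by (rule bounded_linear_imp_has_derivative)
  have "((\<lambda>q. \<Sum>e\<in>Basis. (L q \<bullet> e) * \<rho> q [j e, w]) has_derivative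
      (\<lambda>h. \<Sum>e\<in>Basis. (L p \<bullet> e) * coeff_deriv \<rho> p h [j e, w] + (L h \<bullet> e) * \<rho> p [j e, w])) (at p)"
  proof (rule has_derivative_sum)
    fix e
    show "((\<lambda>q. (L q \<bullet> e) * \<rho> q [j e, w]) has_derivative
        (\<lambda>h. (L p \<bullet> e) * coeff_deriv \<rho> p h [j e, w] + (L h \<bullet> e) * \<rho> p [j e, w])) (at p)"
      by (rule has_derivative_mult[OF has_derivative_inner_left[OF L] k_form_has_derivative[OF assms(1-3)]])
        simp
  qed
  then have "((\<lambda>q. \<Sum>e\<in>Basis. (L q \<bullet> e) * \<rho> q [j e, w]) has_derivative
      (\<lambda>h. coeff_deriv \<rho> p h [j (L p), w] + \<rho> p [j (L h), w])) (at p)"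
    by (simp only: D\<rho> \<rho>[OF assms(3)] sum.distrib)
  then show ?thesis
    by (rule has_derivative_transform_within_open[OF _ assms(2,3)]) (simp only: \<rho>)
qed

section \<open>The radial potential of a closed form with isotropic fibres\<close>

text \<open>Differentiation under the integral of \<open>b\<close> along the segment from \<open>(x, 0)\<close> to \<open>(x, v)\<close>. The
  Leibniz rule needs a convex set of parameters: the product of a ball with the whole fibre.\<close>

lemma has_derivative_integral_fibre_scaling:
  fixes b :: "'a::euclidean_space \<times> 'b::euclidean_space \<Rightarrow> real"
  assumes "open W" "smooth_on (W \<times> UNIV) b" "x \<in> W"
  shows "((\<lambda>(x, v). integral {0..1} (\<lambda>s. b (x, s *\<^sub>R v))) has_derivative
    (\<lambda>(h, k). integral {0..1} (\<lambda>s. frechet_derivative b (at (x, s *\<^sub>R v)) (h, s *\<^sub>R k)))) (at (x, v))"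
proof -
  define S where "S = (\<lambda>s::real. \<lambda>(x::'a, v::'b). (x, s *\<^sub>R v))"
  obtain r where r: "r > 0" "ball x r \<subseteq> W"
    using assms(1,3) open_contains_ball by blast
  define N where "N = ball x r \<times> (UNIV :: 'b set)"
  have op: "open (W \<times> (UNIV :: 'b set))" "open N"
    unfolding N_def by (auto intro: assms(1) open_Times)
  have SN: "S s p \<in> W \<times> UNIV" if "p \<in> N" for s p
    using that r by (auto simp: S_def N_def)
  have blS: "bounded_linear (S s)" for s
    unfolding S_def case_prod_unfold
    by (intro bounded_linear_Pair bounded_linear_fst bounded_linear_scaleR_right
        bounded_linear_compose[OF bounded_linear_scaleR_right bounded_linear_snd])
  have cont_S: "continuous_on (N \<times> {0..1}) (\<lambda>z. S (snd z) (fst z))"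
    unfolding S_def case_prod_unfold by (auto intro!: continuous_intros)
  define F where "F = (\<lambda>p s. Blinfun (\<lambda>h. frechet_derivative b (at (S s p)) (S s h)))"
  have D: "((\<lambda>p. b (S s p)) has_derivative (\<lambda>h. frechet_derivative b (at (S s p)) (S s h))) (at p)"
    if "p \<in> N" for s p
    using has_derivative_compose[OF bounded_linear_imp_has_derivative[OF blS]
        smooth_on_has_derivative[OF assms(2) op(1) SN[OF that]]] .
  have F: "blinfun_apply (F p s) = (\<lambda>h. frechet_derivative b (at (S s p)) (S s h))" if "p \<in> N" for p s
    unfolding F_def using bounded_linear_Blinfun_apply[OF has_derivative_bounded_linear[OF D[OF that]]] .
  have cont_b: "continuous_on (N \<times> {0..1}) (\<lambda>z. b (S (snd z) (fst z)))"
    by (rule continuous_on_compose2[OF smooth_on_continuous[OF assms(2)] cont_S]) (intro image_subsetI SN, auto)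
  have cont_Db: "continuous_on (N \<times> {0..1}) (\<lambda>z. frechet_derivative b (at (S (snd z) (fst z))) u)" for u
    by (rule continuous_on_compose2[OF smooth_on_continuous_derivative[OF assms(2)] cont_S])
      (intro image_subsetI SN, auto)
  have Db_S: "frechet_derivative b (at (S s p)) (S s h) =
      frechet_derivative b (at (S s p)) (fst h, 0) + s * frechet_derivative b (at (S s p)) (0, snd h)"
    if "p \<in> N" for s p h
  proof -
    have lin: "linear (frechet_derivative b (at (S s p)))"
      using smooth_on_has_derivative[OF assms(2) op(1) SN[OF that]] by (rule has_derivative_linear)
    have "S s h = (fst h, 0) + s *\<^sub>R (0, snd h)"
      by (simp add: S_def case_prod_unfold)
    then show ?thesis
      by (simp only: linear_add[OF lin] linear_cmul[OF lin] real_scaleR_def)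
  qed
  have cont_F: "continuous_on (N \<times> {0..1}) (\<lambda>(p, s). F p s)"
  proof (rule continuous_on_blinfun_componentwise)
    fix i
    have "continuous_on (N \<times> {0..1}) (\<lambda>z. frechet_derivative b (at (S (snd z) (fst z))) (fst i, 0)
        + snd z * frechet_derivative b (at (S (snd z) (fst z))) (0, snd i))"
      by (intro continuous_intros cont_Db)
    then show "continuous_on (N \<times> {0..1}) (\<lambda>z. blinfun_apply (case z of (p, s) \<Rightarrow> F p s) i)"
      by (rule continuous_on_eq) (auto simp: F Db_S)
  qed
  have p: "(x, v) \<in> N"
    using r by (simp add: N_def)
  have slice: "continuous_on {0..1} (\<lambda>s. g (p, s))"
    if "continuous_on (N \<times> {0..1}) g" "p \<in> N" for p and g :: "_ \<times> real \<Rightarrow> 'c::topological_space"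
    by (rule continuous_on_compose2[OF that(1)]) (use that(2) in \<open>auto intro!: continuous_intros\<close>)
  have "((\<lambda>p. integral (cbox 0 1) (\<lambda>s. b (S s p))) has_derivative
      blinfun_apply (integral (cbox 0 1) (F (x, v)))) (at (x, v) within N)"
  proof (rule leibniz_rule)
    show "((\<lambda>p. b (S s p)) has_derivative blinfun_apply (F p s)) (at p within N)" if "p \<in> N" for p s
      unfolding F[OF that] using D[OF that] by (rule has_derivative_at_withinI)
    show "(\<lambda>s. b (S s p)) integrable_on cbox 0 1" if "p \<in> N" for p
      using slice[OF cont_b that] by (intro integrable_continuous) simp
    show "continuous_on (N \<times> cbox 0 1) (\<lambda>(p, s). F p s)"
      using cont_F by simp
    show "convex N"
      unfolding N_def by (intro convex_Times) auto
  qed (fact p)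
  moreover have "blinfun_apply (integral (cbox 0 1) (F (x, v)))
      = (\<lambda>h. integral (cbox 0 1) (\<lambda>s. frechet_derivative b (at (S s (x, v))) (S s h)))"
  proof
    fix h
    have "continuous_on {0..1} (F (x, v))"
      using slice[OF cont_F p] by simp
    then have "F (x, v) integrable_on cbox 0 1"
      by (intro integrable_continuous) simp
    then have "blinfun_apply (integral (cbox 0 1) (F (x, v))) h
        = integral (cbox 0 1) (\<lambda>s. blinfun_apply (F (x, v) s) h)"
      by (rule blinfun_apply_integral)
    then show "blinfun_apply (integral (cbox 0 1) (F (x, v))) h
        = integral (cbox 0 1) (\<lambda>s. frechet_derivative b (at (S s (x, v))) (S s h))"
      by (simp add: F[OF p])
  qed
  ultimately have "((\<lambda>p. integral {0..1} (\<lambda>s. b (S s p))) has_derivative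
      (\<lambda>h. integral {0..1} (\<lambda>s. frechet_derivative b (at (S s (x, v))) (S s h)))) (at (x, v))"
    using at_within_open[OF p op(2)] by simp
  then show ?thesis
    by (simp add: S_def case_prod_unfold)
qed

text \<open>The homotopy operator of the fibrewise scaling \<open>(x, v) \<mapsto> (x, s v)\<close>. The usual formula would
  also scale the vertical parts of the vectors \<open>vs\<close> by \<open>s\<close>; for the forms considered below these
  parts do not contribute, and they are left as they are.\<close>

definition radial_potential :: "('a::euclidean_space \<times> 'b::euclidean_space) form \<Rightarrow> ('a \<times> 'b) form" where
  "radial_potential \<rho> = (\<lambda>(x, v) vs. integral {0..1} (\<lambda>s. \<rho> (x, s *\<^sub>R v) ((0, v) # vs)))"

text \<open>The form \<open>\<rho>\<close> stands for \<open>\<alpha>'\<close>. The locale records the two properties of \<open>\<alpha>'\<close> on which the homotopy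
  formula depends.\<close>

locale isotropic_closed_form =
  fixes W :: "'a::euclidean_space set" and \<rho> :: "('a \<times> 'b::euclidean_space) form"
  assumes open_base: "open W"
    and two_form: "k_form 2 (W \<times> UNIV) \<rho>"
    and closed: "form_eq 3 (W \<times> UNIV) (ext_deriv \<rho>) (\<lambda>p vs. 0)"
    and isotropic: "x \<in> W \<Longrightarrow> \<rho> (x, v) [(0, k), (0, k')] = 0"
begin

lemma open_total: "open (W \<times> (UNIV :: 'b set))"
  using open_base by (auto intro: open_Times)

lemmas coeff_linear = k_form_linear_2[OF two_form]
lemmas coeff_swap = k_form_swap[OF two_form]
lemmas coeff_has_derivative = k_form_has_derivative[OF two_form open_total]
lemmas deriv_linear = coeff_deriv_linear_2[OF two_form open_total]
lemmas deriv_linear_dir = coeff_deriv_linear_dir[OF two_form open_total]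

lemma coeff_smooth: "smooth_on (W \<times> UNIV) (\<lambda>p. \<rho> p [u, w])"
  using two_form by (simp add: k_form_def)

lemma closed_cyclic:
  assumes "p \<in> W \<times> UNIV"
  shows "coeff_deriv \<rho> p u [v, w] - coeff_deriv \<rho> p v [u, w] + coeff_deriv \<rho> p w [u, v] = 0"
  using closed assms by (auto simp: form_eq_def ext_deriv_2[symmetric])

lemma deriv_isotropic:
  assumes "p \<in> W \<times> UNIV"
  shows "coeff_deriv \<rho> p h [(0, k), (0, k')] = 0"
proof -
  have "coeff_deriv \<rho> p h [(0, k), (0, k')] = coeff_deriv (\<lambda>q vs. 0) p h []"
    using isotropic by (intro coeff_deriv_cong_open[OF open_total assms]) auto
  then show ?thesis
    by (simp add: coeff_deriv_def)
qed

lemma vertical_slot: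
  assumes "p \<in> W \<times> UNIV"
  shows "\<rho> p [(0, k), (h, k')] = \<rho> p [(0, k), (h, 0)]"
    and "coeff_deriv \<rho> p d [(0, k), (h, k')] = coeff_deriv \<rho> p d [(0, k), (h, 0)]"
proof -
  have split: "(h, k') = (h, 0) + (0, k')"
    by simp
  have "\<rho> p [(0, k), (0, k')] = 0"
    using isotropic assms by auto
  then show "\<rho> p [(0, k), (h, k')] = \<rho> p [(0, k), (h, 0)]"
    unfolding split linear_add[OF coeff_linear(2)[OF assms]] by simp
  show "coeff_deriv \<rho> p d [(0, k), (h, k')] = coeff_deriv \<rho> p d [(0, k), (h, 0)]"
    unfolding split linear_add[OF deriv_linear(2)[OF assms]] using deriv_isotropic[OF assms] by simp
qed

lemma coeff_expand:
  fixes f :: "'a \<times> 'b \<Rightarrow> real"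
  assumes "linear f"
  shows "f (0, k) = (\<Sum>e\<in>Basis. (k \<bullet> e) * f (0, e))"
proof -
  have lin: "linear (\<lambda>k. f (0, k))"
    by (rule linearI)
      (use linear_add[OF assms, of "(0, _)" "(0, _)"] linear_cmul[OF assms, of _ "(0, _)"] in simp_all)
  have "f (0, k) = f (0, \<Sum>e\<in>Basis. (k \<bullet> e) *\<^sub>R e)"
    by (simp only: euclidean_representation)
  also have "\<dots> = (\<Sum>e\<in>Basis. f (0, (k \<bullet> e) *\<^sub>R e))"
    by (rule linear_sum[OF lin])
  also have "\<dots> = (\<Sum>e\<in>Basis. (k \<bullet> e) * f (0, e))"
    using linear_cmul[OF lin] by (intro sum.cong refl) simp
  finally show ?thesis .
qed

lemma continuous_coeff_on_ray:
  assumes "x \<in> W"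
  shows "continuous_on {0..1::real} (\<lambda>s. \<rho> (x, s *\<^sub>R v) [u, w])"
    and "continuous_on {0..1::real} (\<lambda>s. coeff_deriv \<rho> (x, s *\<^sub>R v) h [u, w])"
proof -
  have ray: "continuous_on {0..1::real} (\<lambda>s. (x, s *\<^sub>R v))"
    by (auto intro!: continuous_intros)
  show "continuous_on {0..1::real} (\<lambda>s. \<rho> (x, s *\<^sub>R v) [u, w])"
    by (rule continuous_on_compose2[OF smooth_on_continuous[OF coeff_smooth] ray]) (use assms in auto)
  show "continuous_on {0..1::real} (\<lambda>s. coeff_deriv \<rho> (x, s *\<^sub>R v) h [u, w])"
    unfolding coeff_deriv_def
    by (rule continuous_on_compose2[OF smooth_on_continuous_derivative[OF coeff_smooth] ray])
      (use assms in auto)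
qed

lemma deriv_dir_split:
  assumes "p \<in> W \<times> UNIV"
  shows "coeff_deriv \<rho> p (h, s *\<^sub>R k) [u, w]
    = coeff_deriv \<rho> p (h, 0) [u, w] + s * coeff_deriv \<rho> p (0, k) [u, w]"
proof -
  have "(h, s *\<^sub>R k) = (h, 0) + s *\<^sub>R (0, k)"
    by simp
  then show ?thesis
    using linear_add[OF deriv_linear_dir[OF assms, of "[u, w]"], of "(h, 0)" "s *\<^sub>R (0, k)"]
      linear_cmul[OF deriv_linear_dir[OF assms, of "[u, w]"], of s "(0, k)"] by simp
qed

lemma integrable_on_ray:
  assumes "x \<in> W"
  shows "(\<lambda>s. \<rho> (x, s *\<^sub>R v) [u, w]) integrable_on {0..1}"
    and "(\<lambda>s. coeff_deriv \<rho> (x, s *\<^sub>R v) (h, s *\<^sub>R k) [u, w]) integrable_on {0..1}"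
proof -
  show "(\<lambda>s. \<rho> (x, s *\<^sub>R v) [u, w]) integrable_on {0..1}"
    by (intro integrable_continuous_real continuous_coeff_on_ray assms)
  have p: "(x, s *\<^sub>R v) \<in> W \<times> UNIV" for s
    using assms by simp
  show "(\<lambda>s. coeff_deriv \<rho> (x, s *\<^sub>R v) (h, s *\<^sub>R k) [u, w]) integrable_on {0..1}"
    unfolding deriv_dir_split[OF p]
    by (intro integrable_continuous_real continuous_intros continuous_coeff_on_ray assms)
qed

text \<open>In the first slot of the integrand the fibre coordinate \<open>v\<close> occurs; expanding it in a basis
  leaves integrals of coefficients on fixed vectors.\<close>

lemma radial_potential_has_derivative:
  assumes "x \<in> W"
  shows "((\<lambda>p. radial_potential \<rho> p [u]) has_derivative
    (\<lambda>(h, k). integral {0..1} (\<lambda>s. \<rho> (x, s *\<^sub>R v) [(0, k), u]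
      + coeff_deriv \<rho> (x, s *\<^sub>R v) (h, s *\<^sub>R k) [(0, v), u]))) (at (x, v))"
proof -
  have p: "(x, v) \<in> W \<times> UNIV" and ps: "(x, s *\<^sub>R v) \<in> W \<times> UNIV" for s
    using assms by simp_all
  define I where "I = (\<lambda>e (x, v). integral {0..1} (\<lambda>s. \<rho> (x, s *\<^sub>R v) [(0, e), u]))"
  define DI where "DI = (\<lambda>e (h, k). integral {0..1}
      (\<lambda>s. coeff_deriv \<rho> (x, s *\<^sub>R v) (h, s *\<^sub>R k) [(0, e), u]))"
  have I: "(I e has_derivative DI e) (at (x, v))" for e
    using has_derivative_integral_fibre_scaling[OF open_base coeff_smooth assms, of "(0, e)" u v]
    by (simp add: I_def DI_def coeff_deriv_def)
  have "((\<lambda>q. \<Sum>e\<in>Basis. (snd q \<bullet> e) * I e q) has_derivative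
      (\<lambda>d. \<Sum>e\<in>Basis. (snd (x, v) \<bullet> e) * DI e d + (snd d \<bullet> e) * I e (x, v))) (at (x, v))"
    by (intro has_derivative_sum has_derivative_mult I has_derivative_inner_left
        has_derivative_snd has_derivative_ident)
  moreover have "(\<Sum>e\<in>Basis. (snd (x, v) \<bullet> e) * DI e d + (snd d \<bullet> e) * I e (x, v))
      = (case d of (h, k) \<Rightarrow> integral {0..1} (\<lambda>s. \<rho> (x, s *\<^sub>R v) [(0, k), u]
          + coeff_deriv \<rho> (x, s *\<^sub>R v) (h, s *\<^sub>R k) [(0, v), u]))" for d
  proof (cases d)
    case (Pair h k)
    have "(\<Sum>e\<in>Basis. (snd (x, v) \<bullet> e) * DI e d + (snd d \<bullet> e) * I e (x, v))
        = integral {0..1} (\<lambda>s. \<Sum>e\<in>Basis.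
            (v \<bullet> e) * coeff_deriv \<rho> (x, s *\<^sub>R v) (h, s *\<^sub>R k) [(0, e), u]
            + (k \<bullet> e) * \<rho> (x, s *\<^sub>R v) [(0, e), u])"
      using integrable_on_ray[OF assms]
      by (subst integral_sum) (auto simp: Pair I_def DI_def integral_add integrable_add integrable_on_mult_right)
    also have "\<dots> = integral {0..1} (\<lambda>s. \<rho> (x, s *\<^sub>R v) [(0, k), u]
          + coeff_deriv \<rho> (x, s *\<^sub>R v) (h, s *\<^sub>R k) [(0, v), u])"
    proof (rule integral_cong)
      fix s :: real
      show "(\<Sum>e\<in>Basis. (v \<bullet> e) * coeff_deriv \<rho> (x, s *\<^sub>R v) (h, s *\<^sub>R k) [(0, e), u]
            + (k \<bullet> e) * \<rho> (x, s *\<^sub>R v) [(0, e), u])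
          = \<rho> (x, s *\<^sub>R v) [(0, k), u] + coeff_deriv \<rho> (x, s *\<^sub>R v) (h, s *\<^sub>R k) [(0, v), u]"
        by (simp only: sum.distrib coeff_expand[OF coeff_linear(1)[OF ps], where k = k]
            coeff_expand[OF deriv_linear(1)[OF ps], where k = v] add.commute)
    qed
    finally show ?thesis
      by (simp add: Pair)
  qed
  ultimately have D: "((\<lambda>q. \<Sum>e\<in>Basis. (snd q \<bullet> e) * I e q) has_derivative
    (\<lambda>(h, k). integral {0..1} (\<lambda>s. \<rho> (x, s *\<^sub>R v) [(0, k), u]
      + coeff_deriv \<rho> (x, s *\<^sub>R v) (h, s *\<^sub>R k) [(0, v), u]))) (at (x, v))"
    by simp
  show ?thesis
  proof (rule has_derivative_transform_within_open[OF D open_total p])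
    fix q :: "'a \<times> 'b" assume "q \<in> W \<times> UNIV"
    then obtain y w where q: "q = (y, w)" and y: "y \<in> W"
      by auto
    have ys: "(y, s *\<^sub>R w) \<in> W \<times> UNIV" for s
      using y by simp
    have "radial_potential \<rho> q [u]
        = integral {0..1} (\<lambda>s. \<Sum>e\<in>Basis. (w \<bullet> e) * \<rho> (y, s *\<^sub>R w) [(0, e), u])"
      by (simp add: radial_potential_def q coeff_expand[OF coeff_linear(1)[OF ys], where k = w])
    also have "\<dots> = (\<Sum>e\<in>Basis. (snd q \<bullet> e) * I e q)"
      using integrable_on_ray(1)[OF y]
      by (subst integral_sum) (auto simp: q I_def integrable_on_mult_right)
    finally show "(\<Sum>e\<in>Basis. (snd q \<bullet> e) * I e q) = radial_potential \<rho> q [u]"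
      by simp
  qed
qed

lemma coeff_split:
  assumes "p \<in> W \<times> UNIV"
  shows "\<rho> p [(h, k), (h', k')]
    = \<rho> p [(h, 0), (h', 0)] + (\<rho> p [(0, k), (h', 0)] - \<rho> p [(0, k'), (h, 0)])"
proof -
  have "\<rho> p [(h, k), (h', k')] = \<rho> p [(h, 0) + (0, k), (h', k')]"
    by simp
  also have "\<dots> = \<rho> p [(h, 0), (h', k')] + \<rho> p [(0, k), (h', k')]"
    by (rule linear_add[OF coeff_linear(1)[OF assms]])
  also have "\<rho> p [(h, 0), (h', k')] = \<rho> p [(h, 0), (h', 0) + (0, k')]"
    by simp
  also have "\<dots> = \<rho> p [(h, 0), (h', 0)] + \<rho> p [(h, 0), (0, k')]"
    by (rule linear_add[OF coeff_linear(2)[OF assms]])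
  finally show ?thesis
    using vertical_slot(1)[OF assms, of k h' k'] coeff_swap[OF assms, of "(h, 0)" "(0, k')"] by simp
qed

lemma radial_coeff_deriv:
  assumes "x \<in> W"
  shows "coeff_deriv (radial_potential \<rho>) (x, v) (h, k) [u]
    = integral {0..1} (\<lambda>s. \<rho> (x, s *\<^sub>R v) [(0, k), u]
        + coeff_deriv \<rho> (x, s *\<^sub>R v) (h, s *\<^sub>R k) [(0, v), u])"
  using frechet_derivative_at[OF radial_potential_has_derivative[OF assms, of u v]]
  by (simp add: coeff_deriv_def fun_eq_iff)

text \<open>Let \<open>U\<^sub>s = (h, s k)\<close> and \<open>U'\<^sub>s = (h', s k')\<close>. Closedness on \<open>(0, v), U\<^sub>s, U'\<^sub>s\<close> turns the
  integrand of the exterior derivative into the \<open>s\<close>-derivative of the value of \<open>\<rho>\<close> at \<open>(x, s v)\<close> on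
  \<open>U\<^sub>s, U'\<^sub>s\<close>; the right-hand side is the difference of these values at \<open>s = 1\<close> and \<open>s = 0\<close>.\<close>

lemma ext_deriv_radial_potential:
  assumes "x \<in> W"
  shows "ext_deriv (radial_potential \<rho>) (x, v) [(h, k), (h', k')]
    = \<rho> (x, v) [(h, k), (h', k')] - \<rho> (x, 0) [(h, 0), (h', 0)]"
proof -
  have p: "(x, s *\<^sub>R v) \<in> W \<times> UNIV" for s
    using assms by simp
  \<comment> \<open>\<open>g s\<close> is the value of \<open>\<rho>\<close> at \<open>(x, s v)\<close> on \<open>U\<^sub>s, U'\<^sub>s\<close>; the term with \<open>s\<^sup>2\<close> vanishes by isotropy.\<close>
  define g where "g = (\<lambda>s. \<rho> (x, s *\<^sub>R v) [(h, 0), (h', 0)]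
    + s * (\<rho> (x, s *\<^sub>R v) [(0, k), (h', 0)] - \<rho> (x, s *\<^sub>R v) [(0, k'), (h, 0)]))"
  define g' where "g' = (\<lambda>s. coeff_deriv \<rho> (x, s *\<^sub>R v) (0, v) [(h, 0), (h', 0)]
    + (\<rho> (x, s *\<^sub>R v) [(0, k), (h', 0)] - \<rho> (x, s *\<^sub>R v) [(0, k'), (h, 0)])
    + s * (coeff_deriv \<rho> (x, s *\<^sub>R v) (0, v) [(0, k), (h', 0)]
         - coeff_deriv \<rho> (x, s *\<^sub>R v) (0, v) [(0, k'), (h, 0)]))"
  have ray: "((\<lambda>s. \<rho> (x, s *\<^sub>R v) [u, w]) has_real_derivative
      coeff_deriv \<rho> (x, s *\<^sub>R v) (0, v) [u, w]) (at s)" for s u w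
  proof -
    have "((\<lambda>s. (x, s *\<^sub>R v)) has_derivative (\<lambda>t. (0, t *\<^sub>R v))) (at s)"
      by (auto intro!: derivative_eq_intros)
    from has_derivative_compose[OF this coeff_has_derivative[OF p[of s], of "[u, w]"]]
    have "((\<lambda>s. \<rho> (x, s *\<^sub>R v) [u, w]) has_derivative
        (\<lambda>t. coeff_deriv \<rho> (x, s *\<^sub>R v) (0, t *\<^sub>R v) [u, w])) (at s)"
      by simp
    moreover have "coeff_deriv \<rho> (x, s *\<^sub>R v) (0, t *\<^sub>R v) [u, w]
        = coeff_deriv \<rho> (x, s *\<^sub>R v) (0, v) [u, w] * t" for t
      using linear_cmul[OF deriv_linear_dir[OF p[of s], of "[u, w]"], of t "(0, v)"] by simp
    ultimately show ?thesis
      by (simp add: has_field_derivative_def)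
  qed
  have "(g has_vector_derivative g' s) (at s within {0..1})" for s
  proof (rule has_vector_derivative_at_within)
    have "(g has_real_derivative g' s) (at s)"
      unfolding g_def g'_def by (rule derivative_eq_intros ray refl)+ (simp add: algebra_simps)
    then show "(g has_vector_derivative g' s) (at s)"
      by (simp add: has_real_derivative_iff_has_vector_derivative)
  qed
  then have "(g' has_integral (g 1 - g 0)) {0..1}"
    by (intro fundamental_theorem_of_calculus) auto
  moreover have "g' s = (\<rho> (x, s *\<^sub>R v) [(0, k), (h', k')]
        + coeff_deriv \<rho> (x, s *\<^sub>R v) (h, s *\<^sub>R k) [(0, v), (h', k')])
      - (\<rho> (x, s *\<^sub>R v) [(0, k'), (h, k)]
        + coeff_deriv \<rho> (x, s *\<^sub>R v) (h', s *\<^sub>R k') [(0, v), (h, k)])" for s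
  proof -
    let ?D = "coeff_deriv \<rho> (x, s *\<^sub>R v)"
    have "?D (0, v) [(h, 0), (h', 0)] = ?D (h, 0) [(0, v), (h', 0)] - ?D (h', 0) [(0, v), (h, 0)]"
      "?D (0, v) [(0, k), (h', 0)] = ?D (0, k) [(0, v), (h', 0)]"
      "?D (0, v) [(0, k'), (h, 0)] = ?D (0, k') [(0, v), (h, 0)]"
      using closed_cyclic[OF p[of s], of "(0, v)" "(h, 0)" "(h', 0)"]
        closed_cyclic[OF p[of s], of "(0, v)" "(0, k)" "(h', 0)"]
        closed_cyclic[OF p[of s], of "(0, v)" "(0, k')" "(h, 0)"]
      by (simp_all add: deriv_isotropic[OF p])
    moreover have "?D (h, s *\<^sub>R k) [(0, v), (h', 0)]
        = ?D (h, 0) [(0, v), (h', 0)] + s * ?D (0, k) [(0, v), (h', 0)]"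
      "?D (h', s *\<^sub>R k') [(0, v), (h, 0)]
        = ?D (h', 0) [(0, v), (h, 0)] + s * ?D (0, k') [(0, v), (h, 0)]"
      using deriv_dir_split[OF p] by blast+
    ultimately show ?thesis
      unfolding g'_def vertical_slot(1)[OF p, where k' = k] vertical_slot(1)[OF p, where k' = k']
        vertical_slot(2)[OF p, where k' = k] vertical_slot(2)[OF p, where k' = k']
      by (simp add: algebra_simps)
  qed
  ultimately have "((\<lambda>s. (\<rho> (x, s *\<^sub>R v) [(0, k), (h', k')]
        + coeff_deriv \<rho> (x, s *\<^sub>R v) (h, s *\<^sub>R k) [(0, v), (h', k')])
      - (\<rho> (x, s *\<^sub>R v) [(0, k'), (h, k)]
        + coeff_deriv \<rho> (x, s *\<^sub>R v) (h', s *\<^sub>R k') [(0, v), (h, k)])) has_integral (g 1 - g 0)) {0..1}"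
    by (metis (no_types, lifting) has_integral_cong)
  then have "g 1 - g 0 = ext_deriv (radial_potential \<rho>) (x, v) [(h, k), (h', k')]"
    unfolding ext_deriv_1 radial_coeff_deriv[OF assms]
    by (subst integral_diff[symmetric])
      (auto intro!: integrable_add integrable_on_ray[OF assms] simp: integral_unique)
  then show ?thesis
    using p[of 1] by (simp add: g_def coeff_split[of "(x, v)" h k h' k'])
qed

text \<open>Evaluate \<open>dR\<close> on \<open>(0, w)\<close> and \<open>u\<close>: the term that differentiates \<open>R\<close> on \<open>(0, w)\<close> drops out, since
  \<open>R\<close> vanishes on vertical vectors.\<close>

lemma radial_potential_fibre_deriv:
  assumes "x \<in> W"
  shows "coeff_deriv (radial_potential \<rho>) (x, v) (0, w) [(h, k)] = \<rho> (x, v) [(0, w), (h, 0)]"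
proof -
  have p: "(x, s *\<^sub>R v) \<in> W \<times> UNIV" for s
    using assms by simp
  have "coeff_deriv (radial_potential \<rho>) (x, v) (h, k) [(0, w)] = 0"
    by (simp add: radial_coeff_deriv[OF assms] isotropic[OF assms] deriv_isotropic[OF p])
  moreover have "\<rho> (x, 0) [0, (h, 0)] = 0"
    using linear_0[OF coeff_linear(1)[of "(x, 0)" "(h, 0)"]] assms by simp
  ultimately show ?thesis
    using ext_deriv_radial_potential[OF assms, of v 0 w h k] vertical_slot(1)[of "(x, v)" w h k] assms
    by (simp add: ext_deriv_1 zero_prod_def)
qed

text \<open>Hence \<open>R\<close> is a primitive of the integrands of the homotopy operators along every straight line
  in a fibre.\<close>

lemma radial_potential_line_integral:
  assumes "x \<in> W"
  shows "(LBINT \<nu>=0..ereal c. \<rho> (x, v + \<nu> *\<^sub>R w) [(0, w), (h, 0)])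
    = radial_potential \<rho> (x, v + c *\<^sub>R w) [(h, k)] - radial_potential \<rho> (x, v) [(h, k)]"
proof -
  have p: "(x, v + \<nu> *\<^sub>R w) \<in> W \<times> UNIV" for \<nu>
    using assms by simp
  have "((\<lambda>\<nu>. radial_potential \<rho> (x, v + \<nu> *\<^sub>R w) [(h, k)]) has_vector_derivative
      \<rho> (x, v + \<nu> *\<^sub>R w) [(0, w), (h, 0)]) (at \<nu>)" for \<nu>
  proof -
    let ?D = "\<lambda>d. coeff_deriv (radial_potential \<rho>) (x, v + \<nu> *\<^sub>R w) d [(h, k)]"
    have "((\<lambda>\<nu>. (x, v + \<nu> *\<^sub>R w)) has_derivative (\<lambda>t. (0, t *\<^sub>R w))) (at \<nu>)"
      by (auto intro!: derivative_eq_intros)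
    moreover have D: "((\<lambda>p. radial_potential \<rho> p [(h, k)]) has_derivative ?D) (at (x, v + \<nu> *\<^sub>R w))"
      unfolding coeff_deriv_def
      using radial_potential_has_derivative[OF assms] differentiableI frechet_derivative_works by blast
    ultimately have "((\<lambda>\<nu>. radial_potential \<rho> (x, v + \<nu> *\<^sub>R w) [(h, k)]) has_derivative
        (\<lambda>t. ?D (0, t *\<^sub>R w))) (at \<nu>)"
      by (rule has_derivative_compose)
    moreover have "?D (0, t *\<^sub>R w) = t * ?D (0, w)" for t
      using linear_cmul[OF has_derivative_linear[OF D], of t "(0, w)"] by simp
    ultimately show ?thesis
      by (simp add: has_vector_derivative_def radial_potential_fibre_deriv[OF assms])
  qed
  moreover have "continuous_on S (\<lambda>\<nu>. \<rho> (x, v + \<nu> *\<^sub>R w) [(0, w), (h, 0)])" for S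
    by (rule continuous_on_compose2[OF smooth_on_continuous[OF coeff_smooth]])
      (use assms in \<open>auto intro!: continuous_intros\<close>)
  ultimately show ?thesis
    using interval_integral_FTC_finite[of 0 c "\<lambda>\<nu>. \<rho> (x, v + \<nu> *\<^sub>R w) [(0, w), (h, 0)]"
        "\<lambda>\<nu>. radial_potential \<rho> (x, v + \<nu> *\<^sub>R w) [(h, k)]"]
    by (simp add: has_vector_derivative_at_within zero_ereal_def)
qed

lemma linear_radial_potential:
  assumes "x \<in> W"
  shows "linear (\<lambda>u. radial_potential \<rho> (x, v) [u])"
proof -
  have p: "(x, s *\<^sub>R v) \<in> W \<times> UNIV" for s
    using assms by simp
  show ?thesis
    by (rule linearI)
      (simp_all add: radial_potential_def linear_add[OF coeff_linear(2)[OF p]]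
        linear_cmul[OF coeff_linear(2)[OF p]] integral_add integrable_on_ray[OF assms])
qed

lemma radial_potential_zero_section:
  assumes "x \<in> W"
  shows "radial_potential \<rho> (x, 0) [u] = 0"
  using linear_0[OF coeff_linear(1)[of "(x, 0)" u]] assms
  by (simp add: radial_potential_def zero_prod_def)

end

section \<open>Iterated pull-backs\<close>

text \<open>All projections, and the sections at \<open>0\<close>, are maps of this kind. Composing such maps means
  taking the union of the sets \<open>S\<close>, so an iterated pull-back becomes a single one.\<close>

definition zero_fibre :: "'m set \<Rightarrow> (real ^ 'm) \<times> (real ^ 'm) \<Rightarrow> (real ^ 'm) \<times> (real ^ 'm)" where
  "zero_fibre S = (\<lambda>(x, v). (x, \<chi> k. if k \<in> S then 0 else v $ k))"

lemma zero_fibre_empty: "zero_fibre {} = id"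
  by (simp add: zero_fibre_def fun_eq_iff)

lemma zero_fibre_UNIV: "zero_fibre UNIV (x, v) = (x, 0)"
  by (simp add: zero_fibre_def zero_vec_def)

lemma zero_fibre_comp: "zero_fibre S (zero_fibre T p) = zero_fibre (S \<union> T) p"
  by (cases p) (simp add: zero_fibre_def vec_eq_iff)

lemma fibre_proj_zero_fibre: "fibre_proj ix l = zero_fibre {ix l}"
  by (auto simp: fibre_proj_def zero_fibre_def fun_eq_iff)

lemma fibre_sec_zero_fibre: "fibre_sec ix l 0 = zero_fibre {ix l}"
  by (auto simp: fibre_sec_def zero_fibre_def fun_eq_iff)

lemma pullback_zero_fibre:
  "pullback (zero_fibre S) \<rho> p vs = \<rho> (zero_fibre S p) (map (zero_fibre S) vs)"
proof -
  have "linear (zero_fibre S)"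
    by (rule linearI) (auto simp: zero_fibre_def vec_eq_iff)
  then have "(zero_fibre S has_derivative zero_fibre S) (at p)"
    by (simp add: linear_conv_bounded_linear bounded_linear_imp_has_derivative)
  then show ?thesis
    by (simp add: pullback_def frechet_derivative_at[symmetric])
qed

lemma foldr_pullback_fibre_proj:
  "foldr (\<lambda>j. pullback (fibre_proj ix j)) js \<rho> p vs
    = \<rho> (zero_fibre (ix ` set js) p) (map (zero_fibre (ix ` set js)) vs)"
  by (induction js arbitrary: p vs)
    (simp_all add: zero_fibre_empty fibre_proj_zero_fibre pullback_zero_fibre zero_fibre_comp o_def
      insert_commute)

lemma fold_pullback_fibre_sec:
  "fold (\<lambda>j. pullback (fibre_sec ix j 0)) js \<rho> p vs
    = \<rho> (zero_fibre (ix ` set js) p) (map (zero_fibre (ix ` set js)) vs)"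
  by (induction js arbitrary: \<rho>)
    (simp_all add: zero_fibre_empty fibre_sec_zero_fibre pullback_zero_fibre zero_fibre_comp o_def)

lemma all_sec_all_proj:
  fixes ix :: "nat \<Rightarrow> 'm::finite"
  assumes "ix ` {1..CARD('m)} = UNIV"
  shows "all_sec ix \<circ> all_proj ix = zero_fibre UNIV"
proof -
  have proj: "fold (\<lambda>l g. fibre_proj ix l \<circ> g) js g p = zero_fibre (ix ` set js) (g p)" for js g p
    by (induction js arbitrary: g) (simp_all add: zero_fibre_empty fibre_proj_zero_fibre zero_fibre_comp)
  have sec: "foldr (\<lambda>l g. fibre_sec ix l 0 \<circ> g) js id p = zero_fibre (ix ` set js) p" for js p
    by (induction js) (simp_all add: zero_fibre_empty fibre_sec_zero_fibre zero_fibre_comp)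
  have "ix ` set [1..<Suc CARD('m)] = UNIV"
    using assms by (simp only: set_upt atLeastLessThanSuc_atLeastAtMost)
  then show ?thesis
    by (simp only: fun_eq_iff all_sec_def all_proj_def o_apply proj sec zero_fibre_comp) simp
qed

lemma omega_form_eq:
  fixes ix :: "nat \<Rightarrow> 'm::finite"
  assumes "ix ` {1..CARD('m)} = UNIV"
  shows "omega_form ix \<rho> (x, v) [(h, k), (h', k')] = \<rho> (x, 0) [(h, 0), (h', 0)]"
  by (simp add: omega_form_def all_sec_all_proj[OF assms] pullback_zero_fibre zero_fibre_UNIV)

section \<open>The potential as an integral along a polygon\<close>

text \<open>As \<open>\<nu>\<close> runs from \<open>0\<close> to \<open>v $ ix l\<close>, \<open>fibre_path ix l v \<nu>\<close> runs through the \<open>l\<close>-th edge of the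
  polygon along which \<open>\<kappa>\<close> integrates. Its corners are the points \<open>fibre_tail ix l v\<close>, from \<open>v\<close> at
  \<open>l = 1\<close> to \<open>0\<close> at \<open>l = m + 1\<close>.\<close>

definition fibre_path :: "(nat \<Rightarrow> 'm) \<Rightarrow> nat \<Rightarrow> real ^ 'm \<Rightarrow> real \<Rightarrow> real ^ 'm" where
  "fibre_path ix l v \<nu> = (\<chi> k. if k \<in> ix ` {1..<l} then 0 else if k = ix l then \<nu> else v $ k)"

definition fibre_tail :: "(nat \<Rightarrow> 'm) \<Rightarrow> nat \<Rightarrow> real ^ 'm \<Rightarrow> real ^ 'm" where
  "fibre_tail ix l v = (\<chi> k. if k \<in> ix ` {1..<l} then 0 else v $ k)"

lemma fibre_path_eq:
  assumes "l \<in> {1..m}" "inj_on ix {1..m}"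
  shows "fibre_path ix l v \<nu> = fibre_tail ix (Suc l) v + \<nu> *\<^sub>R axis (ix l) 1"
    and "fibre_tail ix l v = fibre_tail ix (Suc l) v + (v $ ix l) *\<^sub>R axis (ix l) 1"
    and "ix l \<notin> ix ` {1..<l}"
proof -
  show notin: "ix l \<notin> ix ` {1..<l}"
    using assms by (auto dest!: inj_onD)
  have "{1..<Suc l} = insert l {1..<l}"
    using assms(1) by auto
  then have "ix ` {1..<Suc l} = insert (ix l) (ix ` {1..<l})"
    by (simp only: image_insert)
  then have "k \<in> ix ` {1..<Suc l} \<longleftrightarrow> k = ix l \<or> k \<in> ix ` {1..<l}" for k
    by blast
  then show "fibre_path ix l v \<nu> = fibre_tail ix (Suc l) v + \<nu> *\<^sub>R axis (ix l) 1"
    "fibre_tail ix l v = fibre_tail ix (Suc l) v + (v $ ix l) *\<^sub>R axis (ix l) 1"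
    using notin by (auto simp: fibre_path_def fibre_tail_def vec_eq_iff axis_def)
qed

lemma linear_axis_expand:
  fixes f :: "(real ^ 'm) \<times> (real ^ 'm) \<Rightarrow> real"
  assumes "linear f"
  shows "f (h, 0) = (\<Sum>j\<in>UNIV. h $ j * f (axis j 1, 0))"
    and "f (0, h) = (\<Sum>j\<in>UNIV. h $ j * f (0, axis j 1))"
proof -
  have "linear (\<lambda>h. f (h, 0))" "linear (\<lambda>h. f (0, h))"
    using linear_add[OF assms, of "(_, 0)" "(_, 0)"] linear_cmul[OF assms, of _ "(_, 0)"]
      linear_add[OF assms, of "(0, _)" "(0, _)"] linear_cmul[OF assms, of _ "(0, _)"]
    by (auto intro!: linearI)
  moreover have "g h = (\<Sum>j\<in>UNIV. h $ j * g (axis j 1))" if g: "linear g" for g :: "real ^ 'm \<Rightarrow> real"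
  proof -
    have "g h = g (\<Sum>j\<in>UNIV. h $ j *\<^sub>R axis j 1)"
      using basis_expansion[of h] by (simp add: scalar_mult_eq_scaleR)
    also have "\<dots> = (\<Sum>j\<in>UNIV. g (h $ j *\<^sub>R axis j 1))"
      by (rule linear_sum[OF g])
    finally show ?thesis
      by (simp add: linear_cmul[OF g])
  qed
  ultimately show "f (h, 0) = (\<Sum>j\<in>UNIV. h $ j * f (axis j 1, 0))"
    "f (0, h) = (\<Sum>j\<in>UNIV. h $ j * f (0, axis j 1))"
    by blast+
qed

context
  fixes W :: "(real ^ 'm) set" and \<rho> :: "((real ^ 'm) \<times> (real ^ 'm)) form" and ix :: "nat \<Rightarrow> 'm"
  assumes iso: "isotropic_closed_form W \<rho>"
    and bij: "bij_betw ix {1..CARD('m)} UNIV"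
begin

interpretation isotropic_closed_form W \<rho>
  by (fact iso)

text \<open>The pull-backs alter the vector \<open>(h, k)\<close> in its vertical part only, which does not matter next to
  the vertical vector \<open>(0, axis (ix l) 1)\<close>.\<close>

lemma homotopy_summand:
  assumes "l \<in> {1..CARD('m)}" "x \<in> W"
  shows "foldr (\<lambda>j. pullback (fibre_proj ix j)) [1..<l]
      (homotopy_op ix l (fold (\<lambda>j. pullback (fibre_sec ix j 0)) [1..<l] \<rho>)) (x, v) [(h, k)]
    = (LBINT \<nu>=0..ereal (v $ ix l). \<rho> (x, fibre_path ix l v \<nu>) [(0, axis (ix l) 1), (h, 0)])"
proof -
  have inj: "inj_on ix {1..CARD('m)}"
    using bij by (rule bij_betw_imp_inj_on)
  have notin: "ix l \<notin> ix ` {1..<l}"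
    using fibre_path_eq(3)[OF assms(1) inj] .
  let ?Z = "zero_fibre (ix ` {1..<l})"
  have point: "?Z (fibre_sec ix l \<nu> (fibre_proj ix l (?Z (x, v)))) = (x, fibre_path ix l v \<nu>)" for \<nu>
    using notin by (auto simp: zero_fibre_def fibre_sec_def fibre_proj_def fibre_path_def vec_eq_iff)
  have direction: "?Z (0, axis (ix l) 1) = (0, axis (ix l) 1)"
    using notin by (auto simp: zero_fibre_def vec_eq_iff axis_def)
  obtain k' where vector: "?Z (fibre_proj ix l (fibre_proj ix l (?Z (h, k)))) = (h, k')"
    by (auto simp: zero_fibre_def fibre_proj_def)
  have bound: "snd (?Z (x, v)) $ ix l = v $ ix l"
    using notin by (simp add: zero_fibre_def)
  have slot: "\<rho> (x, w) [(0, e), (h, k')] = \<rho> (x, w) [(0, e), (h, 0)]" for w e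
    using assms(2) by (intro vertical_slot(1)) simp
  show ?thesis
    by (simp only: foldr_pullback_fibre_proj fold_pullback_fibre_sec homotopy_op_def contract_def
        pullback_def[of "fibre_proj ix l"] pullback_def[of "fibre_sec ix l _"] fibre_deriv
        set_upt list.map point direction vector bound slot)
qed

text \<open>The summands are the increments of the radial potential along the edges of the polygon.\<close>

lemma kappa_form_eq_radial_potential:
  assumes "x \<in> W"
  shows "kappa_form ix \<rho> (x, v) [u] = radial_potential \<rho> (x, v) [u]"
proof -
  obtain h k where u: "u = (h, k)"
    by (cases u)
  let ?R = "\<lambda>l. radial_potential \<rho> (x, fibre_tail ix l v) [u]"
  have inj: "inj_on ix {1..CARD('m)}"
    using bij by (rule bij_betw_imp_inj_on)
  have "kappa_form ix \<rho> (x, v) [u] = (\<Sum>l=1..CARD('m). ?R l - ?R (Suc l))"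
    unfolding kappa_form_def
  proof (rule sum.cong[OF refl])
    fix l assume l: "l \<in> {1..CARD('m)}"
    show "foldr (\<lambda>j. pullback (fibre_proj ix j)) [1..<l]
        (homotopy_op ix l (fold (\<lambda>j. pullback (fibre_sec ix j 0)) [1..<l] \<rho>)) (x, v) [u]
      = ?R l - ?R (Suc l)"
      unfolding u homotopy_summand[OF l assms] fibre_path_eq(1)[OF l inj] fibre_path_eq(2)[OF l inj]
      by (rule radial_potential_line_integral[OF assms])
  qed
  also have "\<dots> = ?R 1 - ?R (Suc (CARD('m)))"
    using sum_Suc_diff[of 1 "CARD('m)" "\<lambda>l. - ?R l"] by simp
  also have "fibre_tail ix 1 v = v"
    by (simp add: fibre_tail_def vec_eq_iff)
  also have "fibre_tail ix (Suc (CARD('m))) v = 0"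
  proof -
    have "ix ` {1..<Suc (CARD('m))} = UNIV"
      using bij by (simp only: atLeastLessThanSuc_atLeastAtMost bij_betw_def)
    then show ?thesis
      by (simp only: fibre_tail_def UNIV_I if_True zero_vec_def)
  qed
  finally show ?thesis
    by (simp only: radial_potential_zero_section[OF assms] diff_zero)
qed

lemma ext_deriv_kappa_form:
  "form_eq 2 (W \<times> UNIV) (\<lambda>p vs. \<rho> p vs - omega_form ix \<rho> p vs) (ext_deriv (kappa_form ix \<rho>))"
proof -
  have surj: "ix ` {1..CARD('m)} = UNIV"
    using bij by (rule bij_betw_imp_surj_on)
  have "form_eq 1 (W \<times> UNIV) (kappa_form ix \<rho>) (radial_potential \<rho>)"
    using kappa_form_eq_radial_potential by (auto simp: form_eq_def length_Suc_conv)
  then have "form_eq 2 (W \<times> UNIV) (ext_deriv (kappa_form ix \<rho>)) (ext_deriv (radial_potential \<rho>))"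
    using ext_deriv_cong_open[OF _ open_total] by (simp add: numeral_2_eq_2)
  then show ?thesis
    using ext_deriv_radial_potential omega_form_eq[OF surj]
    by (auto simp: form_eq_def length_Suc_conv numeral_2_eq_2)
qed

text \<open>The integrals are increments of the potential, which is linear in its vector; thus they may be
  expanded in the basis vectors \<open>\<partial>/\<partial>x\<^sup>j\<close> without a discussion of integrability. The minus sign
  comes from exchanging \<open>\<partial>/\<partial>xdot\<^sup>l\<close> and \<open>\<partial>/\<partial>x\<^sup>j\<close>.\<close>

lemma kappa_form_coords:
  assumes "x \<in> W"
  shows "kappa_form ix \<rho> (x, v) [(h, k)]
    = - (\<Sum>l=1..CARD('m). \<Sum>j\<in>UNIV.
        (LBINT \<nu>=0..ereal (v $ ix l). \<rho> (x, fibre_path ix l v \<nu>) [(axis j 1, 0), (0, axis (ix l) 1)]) * h $ j)"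
proof -
  have inj: "inj_on ix {1..CARD('m)}"
    using bij by (rule bij_betw_imp_inj_on)
  have p: "(x, y) \<in> W \<times> UNIV" for y
    using assms by simp
  let ?I = "\<lambda>l h. LBINT \<nu>=0..ereal (v $ ix l). \<rho> (x, fibre_path ix l v \<nu>) [(0, axis (ix l) 1), (h, 0)]"
  have "?I l h = - (\<Sum>j\<in>UNIV. (LBINT \<nu>=0..ereal (v $ ix l).
      \<rho> (x, fibre_path ix l v \<nu>) [(axis j 1, 0), (0, axis (ix l) 1)]) * h $ j)"
    if l: "l \<in> {1..CARD('m)}" for l
  proof -
    let ?R = "\<lambda>w h. radial_potential \<rho> (x, w) [(h, 0)]"
    have I: "?I l h = ?R (fibre_tail ix l v) h - ?R (fibre_tail ix (Suc l) v) h" for h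
      unfolding fibre_path_eq(1)[OF l inj] fibre_path_eq(2)[OF l inj]
      by (rule radial_potential_line_integral[OF assms])
    have R: "?R w h = (\<Sum>j\<in>UNIV. h $ j * ?R w (axis j 1))" for w
      by (rule linear_axis_expand(1)[OF linear_radial_potential[OF assms]])
    have swap: "?I l (axis j 1) = - (LBINT \<nu>=0..ereal (v $ ix l).
        \<rho> (x, fibre_path ix l v \<nu>) [(axis j 1, 0), (0, axis (ix l) 1)])" for j
      unfolding coeff_swap[OF p, where w = "(0, axis (ix l) 1)" and u = "(axis j 1, 0)"]
      by (rule interval_lebesgue_integral_uminus)
    have "?I l h = (\<Sum>j\<in>UNIV. ?I l (axis j 1) * h $ j)"
      unfolding I R[of "fibre_tail ix l v"] R[of "fibre_tail ix (Suc l) v"]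
      by (simp only: sum_subtractf right_diff_distrib mult.commute)
    then show ?thesis
      unfolding swap by (simp only: sum_negf mult_minus_left)
  qed
  then show ?thesis
    unfolding kappa_form_def sum_negf[symmetric]
    by (intro sum.cong refl) (simp only: homotopy_summand[OF _ assms])
qed

end

section \<open>Lepage equivalents in a chart\<close>

lemma pullback_bounded_linear:
  assumes "bounded_linear L"
  shows "pullback L \<rho> p vs = \<rho> (L p) (map L vs)"
  using frechet_derivative_at[OF bounded_linear_imp_has_derivative[OF assms, of "at p"]]
  by (simp add: pullback_def)

lemma frechet_derivative_snd_compose:
  fixes t s :: real
  assumes "(f has_derivative D) (at p)"
  shows "frechet_derivative (\<lambda>z. f (snd z)) (at (t, p)) (s, h) = D h"
proof -
  have "((\<lambda>z :: real \<times> _. f (snd z)) has_derivative (\<lambda>z. D (snd z))) (at (t, p))"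
    using has_derivative_compose[OF bounded_linear_imp_has_derivative[OF bounded_linear_snd], of f D "(t, p)"]
      assms by simp
  note D = frechet_derivative_at[OF this]
  show ?thesis
    unfolding D[symmetric] by simp
qed

text \<open>Here \<open>d\<alpha> = d\<alpha>\<^sub>0 \<and> dt + d\<rho>\<close>, where \<open>\<alpha>\<^sub>0\<close> and \<open>\<rho>\<close> do not involve \<open>t\<close>. Evaluation on \<open>\<partial>/\<partial>t\<close> and
  two spatial vectors isolates \<open>d\<alpha>\<^sub>0\<close>; evaluation on three spatial vectors isolates \<open>d\<rho>\<close>.\<close>

lemma closed_components:
  fixes U :: "'e::real_normed_vector set"
  assumes "open U" "k_form 1 U \<alpha>\<^sub>0" "k_form 2 U \<rho>"
    and eq: "form_eq 2 (UNIV \<times> U) \<alpha>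
      (\<lambda>p vs. wedge (pullback snd \<alpha>\<^sub>0) dt p vs + pullback snd \<rho> p vs)"
    and closed: "form_eq 3 (UNIV \<times> U) (ext_deriv \<alpha>) (\<lambda>p vs. 0)"
  shows "form_eq 2 U (ext_deriv \<alpha>\<^sub>0) (\<lambda>p vs. 0)" "form_eq 3 U (ext_deriv \<rho>) (\<lambda>p vs. 0)"
proof -
  let ?z = "\<lambda>p. (0::real, p)"
  have op: "open ((UNIV :: real set) \<times> U)"
    using assms(1) by (auto intro: open_Times)
  have \<alpha>: "\<alpha> (t, q) [(\<tau>, u), (\<tau>', w)] = \<alpha>\<^sub>0 q [u] * \<tau>' - \<alpha>\<^sub>0 q [w] * \<tau> + \<rho> q [u, w]"
    if "q \<in> U" for t q \<tau> \<tau>' u w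
    using eq that by (simp add: form_eq_def wedge_def dt_def pullback_bounded_linear[OF bounded_linear_snd])
  have space: "coeff_deriv \<alpha> (0, p) (\<tau>, h) [(0, u), (0, w)] = coeff_deriv \<rho> p h [u, w]"
    if "p \<in> U" for p \<tau> h u w
  proof -
    have "coeff_deriv \<alpha> (0, p) (\<tau>, h) [(0, u), (0, w)]
        = frechet_derivative (\<lambda>z. \<rho> (snd z) [u, w]) (at (0, p)) (\<tau>, h)"
      unfolding coeff_deriv_def
      using that \<alpha> by (subst frechet_derivative_cong_open[OF op, where g = "\<lambda>z. \<rho> (snd z) [u, w]"]) auto
    also have "\<dots> = coeff_deriv \<rho> p h [u, w]"
      by (rule frechet_derivative_snd_compose[OF k_form_has_derivative[OF assms(3,1) that]]) simp
    finally show ?thesis .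
  qed
  have time: "coeff_deriv \<alpha> (0, p) (\<tau>, h) [(1, 0), (0, w)] = - coeff_deriv \<alpha>\<^sub>0 p h [w]"
    if "p \<in> U" for p \<tau> h w
  proof -
    have "\<rho> q [0, w] = 0" if "q \<in> U" for q
      using linear_0[OF k_form_linear_2(1)[OF assms(3) that]] .
    then have "coeff_deriv \<alpha> (0, p) (\<tau>, h) [(1, 0), (0, w)]
        = frechet_derivative (\<lambda>z. - \<alpha>\<^sub>0 (snd z) [w]) (at (0, p)) (\<tau>, h)"
      unfolding coeff_deriv_def
      using that \<alpha> by (subst frechet_derivative_cong_open[OF op, where g = "\<lambda>z. - \<alpha>\<^sub>0 (snd z) [w]"]) auto
    also have "\<dots> = - coeff_deriv \<alpha>\<^sub>0 p h [w]"
      by (rule frechet_derivative_snd_compose[OF has_derivative_minus[OF k_form_has_derivative[OF assms(2,1) that]]])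
        simp
    finally show ?thesis .
  qed
  have d\<alpha>: "ext_deriv \<alpha> (0, p) [a, b, c] = 0" if "p \<in> U" for p a b c
    using closed that by (simp add: form_eq_def)
  show "form_eq 3 U (ext_deriv \<rho>) (\<lambda>p vs. 0)"
  proof -
    have "ext_deriv \<rho> p [u, v, w] = 0" if "p \<in> U" for p u v w
      using d\<alpha>[OF that, of "(0, u)" "(0, v)" "(0, w)"] by (simp add: ext_deriv_2 space[OF that])
    then show ?thesis
      by (auto simp: form_eq_def length_Suc_conv numeral_3_eq_3)
  qed
  show "form_eq 2 U (ext_deriv \<alpha>\<^sub>0) (\<lambda>p vs. 0)"
  proof -
    have "ext_deriv \<alpha>\<^sub>0 p [u, w] = 0" if "p \<in> U" for p u w
    proof -
      have "coeff_deriv \<rho> p 0 [u, w] = 0"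
        using linear_0[OF coeff_deriv_linear_dir[OF assms(3,1) that, of "[u, w]"]] by simp
      then show ?thesis
        using d\<alpha>[OF that, of "(1, 0)" "(0, u)" "(0, w)"]
        by (simp add: ext_deriv_1 ext_deriv_2 space[OF that] time[OF that])
    qed
    then show ?thesis
      by (auto simp: form_eq_def length_Suc_conv numeral_2_eq_2)
  qed
qed

text \<open>Contraction with the total derivative \<open>(1, v, a, 0)\<close>, on which all \<open>\<omega>\<^sup>i\<close> and \<open>\<omega>dot\<^sup>i\<close> vanish,
  kills every 2-contact form.\<close>

lemma lepage_contraction:
  fixes W :: "(real ^ 'm) set"
  assumes eq: "form_eq 2 (UNIV \<times> W \<times> UNIV) \<alpha>
      (\<lambda>p vs. wedge (pullback snd \<alpha>\<^sub>0) dt p vs + pullback snd \<rho> p vs)"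
    and lin: "k_form 1 (W \<times> UNIV) \<alpha>\<^sub>0"
    and contact: "two_contact (UNIV \<times> W \<times> UNIV \<times> UNIV) (\<lambda>p vs. pullback pi21 \<alpha> p vs - \<epsilon> p vs)"
    and src: "form_eq 2 (UNIV \<times> W \<times> UNIV \<times> UNIV) \<epsilon>
      (\<lambda>p vs. \<Sum>i\<in>UNIV. e i (snd p) * wedge (om i) dt p vs)"
    and x: "x \<in> W"
  shows "(\<Sum>i\<in>UNIV. e i (x, v, a) * x' $ i) = \<alpha>\<^sub>0 (x, v) [(x', v')] - \<rho> (x, v) [(v, a), (x', v')]"
proof -
  let ?p = "(0::real, x, v, a)" and ?D = "(1::real, v, a, 0::real ^ 'm)" and ?u = "(0::real, x', v', 0::real ^ 'm)"
  have om: "om i ?p [?D] = 0" "omdot i ?p [?D] = 0" for i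
    by (simp_all add: om_def omdot_def)
  have "?p \<in> UNIV \<times> W \<times> UNIV \<times> UNIV" "length [?D, ?u] = 2"
    using x by simp_all
  then obtain P Q R where "pullback pi21 \<alpha> ?p [?D, ?u] - \<epsilon> ?p [?D, ?u]
      = (\<Sum>i\<in>UNIV. \<Sum>j\<in>UNIV. P i j ?p * wedge (om i) (om j) ?p [?D, ?u]
          + Q i j ?p * wedge (om i) (omdot j) ?p [?D, ?u]
          + R i j ?p * wedge (omdot i) (omdot j) ?p [?D, ?u])"
    using contact unfolding two_contact_def form_eq_def by blast
  then have "pullback pi21 \<alpha> ?p [?D, ?u] - \<epsilon> ?p [?D, ?u] = 0"
    by (simp add: wedge_def om)
  moreover have "\<epsilon> ?p [?D, ?u] = - (\<Sum>i\<in>UNIV. e i (x, v, a) * x' $ i)"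
    using src x by (simp add: form_eq_def wedge_def om dt_def sum_negf) (simp add: om_def)
  moreover have "pullback pi21 \<alpha> ?p [?D, ?u] = - \<alpha>\<^sub>0 (x, v) [(x', v')] + \<rho> (x, v) [(v, a), (x', v')]"
  proof -
    have "linear (pi21 :: _ \<Rightarrow> real \<times> (real ^ 'm) \<times> (real ^ 'm))"
      by (rule linearI) (auto simp: pi21_def)
    then have "pullback pi21 \<alpha> ?p [?D, ?u] = \<alpha> (0, x, v) [(1, v, a), (0, x', v')]"
      by (simp add: pullback_bounded_linear linear_conv_bounded_linear pi21_def)
    also have "\<dots> = - \<alpha>\<^sub>0 (x, v) [(x', v')] + \<rho> (x, v) [(v, a), (x', v')]"
      using eq x by (simp add: form_eq_def wedge_def dt_def pullback_bounded_linear[OF bounded_linear_snd])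
    finally show ?thesis .
  qed
  ultimately show ?thesis
    by simp
qed

text \<open>What is left of the Lepage equivalent in a chart after this contraction and after splitting off
  \<open>dt\<close>.\<close>

locale lepage_chart =
  fixes W :: "(real ^ 'm) set" and \<alpha>\<^sub>0 \<rho> :: "((real ^ 'm) \<times> (real ^ 'm)) form"
    and e :: "'m \<Rightarrow> (real ^ 'm) \<times> (real ^ 'm) \<times> (real ^ 'm) \<Rightarrow> real"
  assumes open_W: "open W"
    and \<alpha>\<^sub>0_form: "k_form 1 (W \<times> UNIV) \<alpha>\<^sub>0" and \<rho>_form: "k_form 2 (W \<times> UNIV) \<rho>"
    and \<alpha>\<^sub>0_closed: "form_eq 2 (W \<times> UNIV) (ext_deriv \<alpha>\<^sub>0) (\<lambda>p vs. 0)"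
    and \<rho>_closed: "form_eq 3 (W \<times> UNIV) (ext_deriv \<rho>) (\<lambda>p vs. 0)"
    and contraction: "x \<in> W \<Longrightarrow> (\<Sum>i\<in>UNIV. e i (x, v, a) * x' $ i)
      = \<alpha>\<^sub>0 (x, v) [(x', v')] - \<rho> (x, v) [(v, a), (x', v')]"
begin

lemma open_tangent: "open (W \<times> (UNIV :: (real ^ 'm) set))"
  using open_W by (auto intro: open_Times)

text \<open>On a vertical vector the left-hand side of \<open>contraction\<close> is zero for every \<open>a\<close>; compare two
  values of \<open>a\<close>.\<close>

lemma vertical_values:
  assumes "x \<in> W"
  shows "\<rho> (x, v) [(0, k), (0, k')] = 0"
    and "\<alpha>\<^sub>0 (x, v) [(0, k')] = \<rho> (x, v) [(v, 0), (0, k')]"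
proof -
  have p: "(x, v) \<in> W \<times> UNIV"
    using assms by simp
  have *: "\<alpha>\<^sub>0 (x, v) [(0, k')] = \<rho> (x, v) [(v, a), (0, k')]" for a
    using contraction[OF assms, of v a 0 k'] by simp
  show "\<alpha>\<^sub>0 (x, v) [(0, k')] = \<rho> (x, v) [(v, 0), (0, k')]"
    by (rule *)
  have "\<rho> (x, v) [(v, 0) + (0, k), (0, k')] = \<rho> (x, v) [(v, 0), (0, k')] + \<rho> (x, v) [(0, k), (0, k')]"
    by (rule linear_add[OF k_form_linear_2(1)[OF \<rho>_form p]])
  then show "\<rho> (x, v) [(0, k), (0, k')] = 0"
    using *[of 0] *[of k] by simp
qed

sublocale isotropic_closed_form W \<rho>
  by unfold_locales (fact open_W \<rho>_form \<rho>_closed vertical_values(1))+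

lemma velocity_slot_has_derivative:
  assumes "p \<in> W \<times> UNIV"
  shows "((\<lambda>q. \<rho> q [(snd q, 0), w]) has_derivative
    (\<lambda>h. coeff_deriv \<rho> p h [(snd p, 0), w] + \<rho> p [(snd h, 0), w])) (at p)"
proof -
  have "linear (\<lambda>v :: real ^ 'm. (v, 0 :: real ^ 'm))"
    by (rule linearI) auto
  from has_derivative_linear_slot[OF \<rho>_form open_tangent assms bounded_linear_snd this]
  show ?thesis .
qed

text \<open>This differentiates \<open>\<alpha>\<^sub>0(0, k) = \<rho>((v, 0), (0, k))\<close>, in which \<open>v\<close> occurs both in the base point
  and in the slot.\<close>

lemma \<alpha>\<^sub>0_vertical_deriv:
  assumes "(x, v) \<in> W \<times> UNIV"
  shows "coeff_deriv \<alpha>\<^sub>0 (x, v) h [(0, k)] = coeff_deriv \<rho> (x, v) h [(v, 0), (0, k)] + \<rho> (x, v) [(snd h, 0), (0, k)]"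
proof -
  have "frechet_derivative (\<lambda>q. \<alpha>\<^sub>0 q [(0, k)]) (at (x, v))
      = frechet_derivative (\<lambda>q. \<rho> q [(snd q, 0), (0, k)]) (at (x, v))"
    using vertical_values(2) by (intro frechet_derivative_cong_open[OF open_tangent assms]) auto
  moreover note D = frechet_derivative_at[OF velocity_slot_has_derivative[OF assms, of "(0, k)"]]
  ultimately show ?thesis
    unfolding coeff_deriv_def[of \<alpha>\<^sub>0] D[symmetric] by simp
qed

lemma \<alpha>\<^sub>0_closed_swap:
  assumes "p \<in> W \<times> UNIV"
  shows "coeff_deriv \<alpha>\<^sub>0 p u [w] = coeff_deriv \<alpha>\<^sub>0 p w [u]"
proof -
  have "ext_deriv \<alpha>\<^sub>0 p [u, w] = 0"
    using \<alpha>\<^sub>0_closed assms unfolding form_eq_def by auto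
  then show ?thesis
    by (simp add: ext_deriv_1)
qed

text \<open>The condition \<open>B\<^sub>i\<^sub>j = B\<^sub>j\<^sub>i\<close>. The vertical components of \<open>d\<alpha>\<^sub>0 = 0\<close> express \<open>B\<^sub>i\<^sub>j - B\<^sub>j\<^sub>i\<close> by
  the differences \<open>\<partial>B\<^sub>k\<^sub>j/\<partial>xdot\<^sup>i - \<partial>B\<^sub>k\<^sub>i/\<partial>xdot\<^sup>j\<close>, and these are the components of \<open>d\<rho> = 0\<close> with two
  vertical slots.\<close>

lemma mixed_symmetric:
  assumes p: "(x, v) \<in> W \<times> UNIV"
  shows "\<rho> (x, v) [(a, 0), (0, b)] = \<rho> (x, v) [(b, 0), (0, a)]"
proof -
  let ?D = "\<lambda>k. coeff_deriv \<rho> (x, v) (0, k)"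
  have "?D a [(v, 0), (0, b)] + \<rho> (x, v) [(a, 0), (0, b)] = ?D b [(v, 0), (0, a)] + \<rho> (x, v) [(b, 0), (0, a)]"
    using \<alpha>\<^sub>0_closed_swap[OF p, of "(0, a)" "(0, b)"] by (simp add: \<alpha>\<^sub>0_vertical_deriv[OF p])
  moreover have "?D a [(v, 0), (0, b)] = ?D b [(v, 0), (0, a)]"
    using closed_cyclic[OF p, of "(v, 0)" "(0, a)" "(0, b)"] deriv_isotropic[OF p] by simp
  ultimately show ?thesis
    by simp
qed

text \<open>The coefficients \<open>A\<^sub>i\<close> and \<open>B\<^sub>i\<^sub>j\<close> of \<open>e\<^sub>i = A\<^sub>i + B\<^sub>i\<^sub>j a\<^sup>j\<close>, named after their part in the
  equations of motion.\<close>

definition force :: "'m \<Rightarrow> (real ^ 'm) \<times> (real ^ 'm) \<Rightarrow> real" where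
  "force i = (\<lambda>(x, v). e i (x, v, 0))"

definition mass :: "'m \<Rightarrow> 'm \<Rightarrow> (real ^ 'm) \<times> (real ^ 'm) \<Rightarrow> real" where
  "mass i j p = \<rho> p [(axis i 1, 0), (0, axis j 1)]"

lemma source_value:
  assumes "x \<in> W"
  shows "e i (x, v, a) = \<alpha>\<^sub>0 (x, v) [(axis i 1, 0)] - \<rho> (x, v) [(v, a), (axis i 1, 0)]"
proof -
  have "(\<Sum>j\<in>UNIV. e j (x, v, a) * axis i 1 $ j) = (\<Sum>j\<in>UNIV. if j = i then e i (x, v, a) else 0)"
    by (intro sum.cong) (auto simp: axis_def)
  then show ?thesis
    using contraction[OF assms, of v a "axis i 1" 0] by simp
qed

lemma source_affine:
  assumes "x \<in> W"
  shows "e i (x, v, a) = force i (x, v) + (\<Sum>j\<in>UNIV. mass i j (x, v) * a $ j)"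
proof -
  have p: "(x, v) \<in> W \<times> UNIV"
    using assms by simp
  have "\<rho> (x, v) [(v, 0) + (0, a), (axis i 1, 0)]
      = \<rho> (x, v) [(v, 0), (axis i 1, 0)] + \<rho> (x, v) [(0, a), (axis i 1, 0)]"
    by (rule linear_add[OF coeff_linear(1)[OF p]])
  then have "e i (x, v, a) = force i (x, v) + \<rho> (x, v) [(axis i 1, 0), (0, a)]"
    using coeff_swap[OF p, of "(0, a)" "(axis i 1, 0)"]
    by (simp add: force_def source_value[OF assms])
  also have "\<rho> (x, v) [(axis i 1, 0), (0, a)] = (\<Sum>j\<in>UNIV. a $ j * mass i j (x, v))"
    unfolding mass_def by (rule linear_axis_expand(2)[OF coeff_linear(2)[OF p]])
  finally show ?thesis
    by (simp add: mult.commute)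
qed

text \<open>Differentiate \<open>A\<^sub>i = \<alpha>\<^sub>0(\<partial>/\<partial>x\<^sup>i) - \<rho>((v, 0), \<partial>/\<partial>x\<^sup>i)\<close>. By \<open>d\<alpha>\<^sub>0 = 0\<close> the derivative of the first
  term is one of the vertical component of \<open>\<alpha>\<^sub>0\<close>, which \<open>\<rho>\<close> determines, and \<open>d\<rho> = 0\<close> combines the
  derivatives of \<open>\<rho>\<close> into a single one, the derivative of \<open>B\<^sub>i\<^sub>j\<close> in the direction of \<open>v\<close>.\<close>

lemma force_vderiv:
  assumes p: "(x, v) \<in> W \<times> UNIV"
  shows "pd (0, axis j 1) (force i) (x, v)
    = coeff_deriv \<rho> (x, v) (v, 0) [(axis i 1, 0), (0, axis j 1)] - \<rho> (x, v) [(axis j 1, 0), (axis i 1, 0)]"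
proof -
  let ?i = "(axis i 1, 0)" and ?j = "(0, axis j 1)"
  have "((\<lambda>q. \<alpha>\<^sub>0 q [?i] - \<rho> q [(snd q, 0), ?i]) has_derivative
      (\<lambda>h. coeff_deriv \<alpha>\<^sub>0 (x, v) h [?i]
        - (coeff_deriv \<rho> (x, v) h [(v, 0), ?i] + \<rho> (x, v) [(snd h, 0), ?i]))) (at (x, v))"
    using has_derivative_diff[OF k_form_has_derivative[OF \<alpha>\<^sub>0_form open_tangent p, of "[?i]"]
        velocity_slot_has_derivative[OF p, of ?i]] by simp
  then have "(force i has_derivative
      (\<lambda>h. coeff_deriv \<alpha>\<^sub>0 (x, v) h [?i]
        - (coeff_deriv \<rho> (x, v) h [(v, 0), ?i] + \<rho> (x, v) [(snd h, 0), ?i]))) (at (x, v))"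
    by (rule has_derivative_transform_within_open[OF _ open_tangent p])
      (auto simp: force_def source_value)
  note D = frechet_derivative_at[OF this]
  have "pd ?j (force i) (x, v) = coeff_deriv \<alpha>\<^sub>0 (x, v) ?j [?i]
      - (coeff_deriv \<rho> (x, v) ?j [(v, 0), ?i] + \<rho> (x, v) [(axis j 1, 0), ?i])"
    unfolding pd_def D[symmetric] by simp
  also have "coeff_deriv \<alpha>\<^sub>0 (x, v) ?j [?i] = coeff_deriv \<rho> (x, v) ?i [(v, 0), ?j]"
  proof -
    have "\<rho> (x, v) [(0, 0), ?j] = 0"
      using linear_0[OF coeff_linear(1)[OF p, of ?j]] by (simp add: zero_prod_def)
    then show ?thesis
      by (simp add: \<alpha>\<^sub>0_closed_swap[OF p, of ?j ?i] \<alpha>\<^sub>0_vertical_deriv[OF p])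
  qed
  finally show ?thesis
    using closed_cyclic[OF p, of "(v, 0)" ?i ?j] by simp
qed

text \<open>By the symmetry of \<open>B\<close> its derivative in the direction of \<open>v\<close> disappears under alternation.\<close>

lemma alt_vderiv_force:
  assumes p: "p \<in> W \<times> UNIV"
  shows "alt_vderiv force i j p = 2 * \<rho> p [(axis i 1, 0), (axis j 1, 0)]"
proof -
  obtain x v where xv: "p = (x, v)"
    by (cases p)
  have p': "(x, v) \<in> W \<times> UNIV"
    using p xv by simp
  have "coeff_deriv \<rho> (x, v) h [(axis i 1, 0), (0, axis j 1)]
      = coeff_deriv \<rho> (x, v) h [(axis j 1, 0), (0, axis i 1)]" for h
    using mixed_symmetric by (intro coeff_deriv_cong_open[OF open_tangent p']) auto
  then show ?thesis
    using coeff_swap[OF p', of "(axis j 1, 0)" "(axis i 1, 0)"]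
    by (simp add: alt_vderiv_def xv force_vderiv[OF p'])
qed

text \<open>The factor \<open>1/4\<close> is \<open>1/2\<close> from \<open>alt_vderiv_force\<close> times \<open>1/2\<close>, because every pair of indices
  occurs twice in the sum of exterior products.\<close>

lemma horizontal_expand:
  assumes p: "p \<in> W \<times> UNIV"
  shows "\<rho> p [(h, 0), (h', 0)]
    = 1/4 * (\<Sum>i\<in>UNIV. \<Sum>j\<in>UNIV. alt_vderiv force i j p * (h $ i * h' $ j - h' $ i * h $ j))"
proof -
  have bilinear: "\<rho> p [(a, 0), (b, 0)]
      = (\<Sum>i\<in>UNIV. \<Sum>j\<in>UNIV. \<rho> p [(axis i 1, 0), (axis j 1, 0)] * (a $ i * b $ j))" for a b
  proof -
    have "\<rho> p [(a, 0), (b, 0)] = (\<Sum>i\<in>UNIV. a $ i * \<rho> p [(axis i 1, 0), (b, 0)])"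
      by (rule linear_axis_expand(1)[OF coeff_linear(1)[OF p]])
    moreover have "\<rho> p [(axis i 1, 0), (b, 0)] = (\<Sum>j\<in>UNIV. b $ j * \<rho> p [(axis i 1, 0), (axis j 1, 0)])" for i
      by (rule linear_axis_expand(1)[OF coeff_linear(2)[OF p]])
    ultimately show ?thesis
      by (simp add: sum_distrib_left mult_ac)
  qed
  have "(\<Sum>i\<in>UNIV. \<Sum>j\<in>UNIV. alt_vderiv force i j p * (h $ i * h' $ j - h' $ i * h $ j))
      = 2 * \<rho> p [(h, 0), (h', 0)] - 2 * \<rho> p [(h', 0), (h, 0)]"
    unfolding bilinear[of h h'] bilinear[of h' h] alt_vderiv_force[OF p]
    by (simp add: sum_distrib_left sum_subtractf right_diff_distrib mult.assoc)
  then show ?thesis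
    using coeff_swap[OF p, of "(h', 0)" "(h, 0)"] by simp
qed

lemma coordinate_expression:
  "form_eq 2 (W \<times> UNIV) \<rho>
    (\<lambda>p vs. 1/4 * (\<Sum>i\<in>UNIV. \<Sum>j\<in>UNIV. alt_vderiv force i j p * wedge (dx i) (dx j) p vs)
          + (\<Sum>i\<in>UNIV. \<Sum>j\<in>UNIV. mass i j p * wedge (dx i) (dxdot j) p vs))"
proof -
  have "\<rho> p [(h, k), (h', k')]
      = 1/4 * (\<Sum>i\<in>UNIV. \<Sum>j\<in>UNIV. alt_vderiv force i j p * wedge (dx i) (dx j) p [(h, k), (h', k')])
          + (\<Sum>i\<in>UNIV. \<Sum>j\<in>UNIV. mass i j p * wedge (dx i) (dxdot j) p [(h, k), (h', k')])"
    if p: "p \<in> W \<times> UNIV" for p h k h' k'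
  proof -
    have mixed: "\<rho> p [(a, 0), (0, b)] = (\<Sum>i\<in>UNIV. \<Sum>j\<in>UNIV. mass i j p * (a $ i * b $ j))" for a b
    proof -
      have "\<rho> p [(a, 0), (0, b)] = (\<Sum>i\<in>UNIV. a $ i * \<rho> p [(axis i 1, 0), (0, b)])"
        by (rule linear_axis_expand(1)[OF coeff_linear(1)[OF p]])
      moreover have "\<rho> p [(axis i 1, 0), (0, b)] = (\<Sum>j\<in>UNIV. b $ j * mass i j p)" for i
        unfolding mass_def by (rule linear_axis_expand(2)[OF coeff_linear(2)[OF p]])
      ultimately show ?thesis
        by (simp add: sum_distrib_left mult_ac)
    qed
    have "\<rho> p [(h, k), (h', k')]
        = \<rho> p [(h, 0), (h', 0)] + (\<rho> p [(h, 0), (0, k')] - \<rho> p [(h', 0), (0, k)])"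
      using coeff_split[OF p, of h k h' k'] coeff_swap[OF p, of "(0, k)" "(h', 0)"]
        coeff_swap[OF p, of "(0, k')" "(h, 0)"] by simp
    also have "\<rho> p [(h, 0), (0, k')] - \<rho> p [(h', 0), (0, k)]
        = (\<Sum>i\<in>UNIV. \<Sum>j\<in>UNIV. mass i j p * wedge (dx i) (dxdot j) p [(h, k), (h', k')])"
      by (simp add: mixed wedge_def dx_def dxdot_def right_diff_distrib sum_subtractf)
    finally show ?thesis
      by (simp add: horizontal_expand[OF p] wedge_def dx_def)
  qed
  then show ?thesis
    by (auto simp: form_eq_def length_Suc_conv numeral_2_eq_2)
qed

lemma force_smooth:
  assumes "smooth_on (W \<times> UNIV \<times> UNIV) (e i)"
  shows "smooth_on (W \<times> UNIV) (force i)"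
proof -
  have "bounded_linear (\<lambda>(x, v). (x, v, 0 :: real ^ 'm))"
    unfolding case_prod_unfold
    by (intro bounded_linear_Pair bounded_linear_fst bounded_linear_snd bounded_linear_zero)
  then have "smooth_on (W \<times> (UNIV :: (real ^ 'm) set)) (\<lambda>p. e i ((\<lambda>(x, v). (x, v, 0)) p))"
    using open_W by (intro smooth_on_compose_linear[OF assms _ open_tangent]) (auto intro!: open_Times)
  then show ?thesis
    by (simp add: force_def case_prod_unfold)
qed

lemma mass_smooth: "smooth_on (W \<times> UNIV) (mass i j)"
  using coeff_smooth unfolding mass_def[abs_def] by blast

end

section \<open>The homotopy formula in every chart\<close>

theorem theorem8:
  fixes Atl :: "('a::{t2_space,second_countable_topology}, real ^ 'm) chart set"
    and ix :: "nat \<Rightarrow> 'm"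
    and \<epsilon> :: "('a, real ^ 'm) chart \<Rightarrow>
          (real \<times> (real ^ 'm) \<times> (real ^ 'm) \<times> (real ^ 'm)) form"
    and \<alpha>\<^sub>\<epsilon> :: "('a, real ^ 'm) chart \<Rightarrow> (real \<times> (real ^ 'm) \<times> (real ^ 'm)) form"
    and \<alpha>\<^sub>0 \<alpha>' :: "('a, real ^ 'm) chart \<Rightarrow> ((real ^ 'm) \<times> (real ^ 'm)) form"
  assumes "smooth_manifold Atl"
    and "CARD('m) \<ge> 2"
    and "bij_betw ix {1..CARD('m)} UNIV"
    and "source_form Atl \<epsilon>"
    and "locally_variational Atl \<epsilon>"
    and "lepage_equivalent Atl \<epsilon> \<alpha>\<^sub>\<epsilon>"
    and "form_on 1 (T1 Atl) Atl \<alpha>\<^sub>0"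
    and "form_on 2 (T1 Atl) Atl \<alpha>'"
    and "\<forall>c\<in>Atl. form_eq 2 (img (RT1 Atl c)) (\<alpha>\<^sub>\<epsilon> c)
           (\<lambda>p vs. wedge (pullback snd (\<alpha>\<^sub>0 c)) dt p vs + pullback snd (\<alpha>' c) p vs)"
  shows "\<forall>c\<in>Atl. \<exists>A B.
    (\<forall>i. smooth_on (img (T1 Atl c)) (A i)) \<and>
    (\<forall>i j. smooth_on (img (T1 Atl c)) (B i j)) \<and>
    source_expr Atl c \<epsilon> (\<lambda>i (x, v, a). A i (x, v) + (\<Sum>j\<in>UNIV. B i j (x, v) * a $ j)) \<and>
    form_eq 2 (img (T1 Atl c)) (\<alpha>' c)
      (\<lambda>p vs. 1/4 * (\<Sum>i\<in>UNIV. \<Sum>j\<in>UNIV. alt_vderiv A i j p * wedge (dx i) (dx j) p vs)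
            + (\<Sum>i\<in>UNIV. \<Sum>j\<in>UNIV. B i j p * wedge (dx i) (dxdot j) p vs)) \<and>
    form_eq 2 (img (T1 Atl c))
      (\<lambda>p vs. \<alpha>' c p vs - omega_form ix (\<alpha>' c) p vs)
      (ext_deriv (kappa_form ix (\<alpha>' c))) \<and>
    form_eq 2 (img (T1 Atl c)) (omega_form ix (\<alpha>' c))
      (\<lambda>(x, v) vs. 1/4 * (\<Sum>i\<in>UNIV. \<Sum>j\<in>UNIV.
         alt_vderiv A i j (x, 0) * wedge (dx i) (dx j) (x, v) vs)) \<and>
    form_eq 1 (img (T1 Atl c)) (kappa_form ix (\<alpha>' c))
      (\<lambda>(x, v) vs. - (\<Sum>l=1..CARD('m). \<Sum>j\<in>UNIV.
         (LBINT \<nu>=0..ereal (v $ ix l). B j (ix l)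
            (x, \<chi> k. if k \<in> ix ` {1..<l} then 0 else if k = ix l then \<nu> else v $ k))
         * dx j (x, v) vs))"
proof
  fix c assume c: "c \<in> Atl"
  let ?W = "img c"
  have chart: "is_chart c"
    using assms(1) c by (simp add: smooth_manifold_def)
  then have open_W: "open ?W"
    by (simp add: is_chart_def)
  note T1_img = img_T1[OF c chart] and T2_img = img_T2[OF c chart]
  have RT1_img: "img (RT1 Atl c) = UNIV \<times> ?W \<times> UNIV"
    and RT2_img: "img (RT2 Atl c) = UNIV \<times> ?W \<times> UNIV \<times> UNIV"
    by (simp_all add: img_time_chart T1_img T2_img)
  obtain e where e: "source_expr Atl c \<epsilon> e"
    using assms(4) c by (auto simp: source_form_def)
  have \<alpha>\<^sub>0: "k_form 1 (?W \<times> UNIV) (\<alpha>\<^sub>0 c)" and \<alpha>': "k_form 2 (?W \<times> UNIV) (\<alpha>' c)"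
    using assms(7,8) c unfolding T1_img[symmetric] form_on_def by blast+
  have decomposition: "form_eq 2 (UNIV \<times> ?W \<times> UNIV) (\<alpha>\<^sub>\<epsilon> c)
      (\<lambda>p vs. wedge (pullback snd (\<alpha>\<^sub>0 c)) dt p vs + pullback snd (\<alpha>' c) p vs)"
    using assms(9) c unfolding RT1_img[symmetric] by blast
  have closed: "form_eq 3 (UNIV \<times> ?W \<times> UNIV) (ext_deriv (\<alpha>\<^sub>\<epsilon> c)) (\<lambda>p vs. 0)"
    using assms(6) c unfolding RT1_img[symmetric] lepage_equivalent_def by blast
  have contact: "two_contact (UNIV \<times> ?W \<times> UNIV \<times> UNIV) (\<lambda>p vs. pullback pi21 (\<alpha>\<^sub>\<epsilon> c) p vs - \<epsilon> c p vs)"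
    using assms(6) c unfolding RT2_img[symmetric] lepage_equivalent_def by blast
  have source: "form_eq 2 (UNIV \<times> ?W \<times> UNIV \<times> UNIV) (\<epsilon> c)
      (\<lambda>p vs. \<Sum>i\<in>UNIV. e i (snd p) * wedge (om i) dt p vs)"
    and e_smooth: "smooth_on (?W \<times> UNIV \<times> UNIV) (e i)" for i
    using e unfolding source_expr_def RT2_img T2_img by blast+
  have op: "open (?W \<times> (UNIV :: (real ^ 'm) set))"
    using open_W by (auto intro: open_Times)
  \<comment> \<open>No special form of \<open>e\<close> is presupposed: the contraction formula shows that \<open>e\<close> is affine in the acceleration.\<close>
  interpret L: lepage_chart ?W "\<alpha>\<^sub>0 c" "\<alpha>' c" e
  proof
    show "form_eq 2 (?W \<times> UNIV) (ext_deriv (\<alpha>\<^sub>0 c)) (\<lambda>p vs. 0)"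
      "form_eq 3 (?W \<times> UNIV) (ext_deriv (\<alpha>' c)) (\<lambda>p vs. 0)"
      using closed_components[OF op \<alpha>\<^sub>0 \<alpha>' decomposition closed] by auto
    show "(\<Sum>i\<in>UNIV. e i (x, v, a) * x' $ i) = \<alpha>\<^sub>0 c (x, v) [(x', v')] - \<alpha>' c (x, v) [(v, a), (x', v')]"
      if "x \<in> ?W" for x v a x' v'
      by (rule lepage_contraction[OF decomposition \<alpha>\<^sub>0 contact source that])
  qed (fact open_W \<alpha>\<^sub>0 \<alpha>')+
  have iso: "isotropic_closed_form ?W (\<alpha>' c)"
    by unfold_locales
  have surj: "ix ` {1..CARD('m)} = UNIV"
    using assms(3) by (rule bij_betw_imp_surj_on)
  have e_affine: "e i p = (case p of (x, v, a) \<Rightarrow> L.force i (x, v) + (\<Sum>j\<in>UNIV. L.mass i j (x, v) * a $ j))"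
    if "p \<in> ?W \<times> UNIV \<times> UNIV" for i p
    using that L.source_affine by auto
  have "source_expr Atl c \<epsilon> (\<lambda>i (x, v, a). L.force i (x, v) + (\<Sum>j\<in>UNIV. L.mass i j (x, v) * a $ j))"
    unfolding source_expr_def img_time_chart T2_img
  proof (intro conjI allI)
    show "smooth_on (?W \<times> UNIV \<times> UNIV)
        (\<lambda>(x, v, a). L.force i (x, v) + (\<Sum>j\<in>UNIV. L.mass i j (x, v) * a $ j))" for i
      by (rule smooth_on_cong[OF _ e_affine e_smooth]) (use open_W in \<open>auto intro!: open_Times\<close>)
    show "form_eq 2 (UNIV \<times> ?W \<times> UNIV \<times> UNIV) (\<epsilon> c) (\<lambda>p vs. \<Sum>i\<in>UNIV.
        (case snd p of (x, v, a) \<Rightarrow> L.force i (x, v) + (\<Sum>j\<in>UNIV. L.mass i j (x, v) * a $ j))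
        * wedge (om i) dt p vs)"
      using source e_affine by (simp add: form_eq_def)
  qed
  moreover have "form_eq 2 (?W \<times> UNIV) (omega_form ix (\<alpha>' c))
      (\<lambda>(x, v) vs. 1/4 * (\<Sum>i\<in>UNIV. \<Sum>j\<in>UNIV.
         alt_vderiv L.force i j (x, 0) * wedge (dx i) (dx j) (x, v) vs))"
    by (auto simp: form_eq_def length_Suc_conv numeral_2_eq_2 omega_form_eq[OF surj]
        L.horizontal_expand wedge_def dx_def)
  moreover have "form_eq 1 (?W \<times> UNIV) (kappa_form ix (\<alpha>' c))
      (\<lambda>(x, v) vs. - (\<Sum>l=1..CARD('m). \<Sum>j\<in>UNIV.
         (LBINT \<nu>=0..ereal (v $ ix l). L.mass j (ix l)
            (x, \<chi> k. if k \<in> ix ` {1..<l} then 0 else if k = ix l then \<nu> else v $ k))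
         * dx j (x, v) vs))"
    unfolding fibre_path_def[symmetric] L.mass_def form_eq_def
    by (auto simp: length_Suc_conv kappa_form_coords[OF iso assms(3)] dx_def)
  ultimately show "\<exists>A B.
    (\<forall>i. smooth_on (img (T1 Atl c)) (A i)) \<and>
    (\<forall>i j. smooth_on (img (T1 Atl c)) (B i j)) \<and>
    source_expr Atl c \<epsilon> (\<lambda>i (x, v, a). A i (x, v) + (\<Sum>j\<in>UNIV. B i j (x, v) * a $ j)) \<and>
    form_eq 2 (img (T1 Atl c)) (\<alpha>' c)
      (\<lambda>p vs. 1/4 * (\<Sum>i\<in>UNIV. \<Sum>j\<in>UNIV. alt_vderiv A i j p * wedge (dx i) (dx j) p vs)
            + (\<Sum>i\<in>UNIV. \<Sum>j\<in>UNIV. B i j p * wedge (dx i) (dxdot j) p vs)) \<and>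
    form_eq 2 (img (T1 Atl c))
      (\<lambda>p vs. \<alpha>' c p vs - omega_form ix (\<alpha>' c) p vs)
      (ext_deriv (kappa_form ix (\<alpha>' c))) \<and>
    form_eq 2 (img (T1 Atl c)) (omega_form ix (\<alpha>' c))
      (\<lambda>(x, v) vs. 1/4 * (\<Sum>i\<in>UNIV. \<Sum>j\<in>UNIV.
         alt_vderiv A i j (x, 0) * wedge (dx i) (dx j) (x, v) vs)) \<and>
    form_eq 1 (img (T1 Atl c)) (kappa_form ix (\<alpha>' c))
      (\<lambda>(x, v) vs. - (\<Sum>l=1..CARD('m). \<Sum>j\<in>UNIV.
         (LBINT \<nu>=0..ereal (v $ ix l). B j (ix l)
            (x, \<chi> k. if k \<in> ix ` {1..<l} then 0 else if k = ix l then \<nu> else v $ k))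
         * dx j (x, v) vs))"
    unfolding T1_img
    using L.force_smooth[OF e_smooth] L.mass_smooth L.coordinate_expression
      ext_deriv_kappa_form[OF iso assms(3)]
    by (intro exI[of _ L.force] exI[of _ L.mass] conjI allI) assumption+
qed

end
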